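(* Let $f(z)$ be an entire function with $f(0)=1$, and let $g(z):={}_{1}F_{1}(\alpha;\gamma;z)$ be a confluent hypergeometric function, where $\alpha,\gamma\in\mathbb{C}$ and $\gamma\neq 0,-1,-2,\cdots$. Suppose that $f$ and $g$ share $0$ CM, that there exists a finite nonzero complex number $a$ such that $\overline{E}_{f}(a)\subseteq\overline{E}_{g}(a)$, and that $f'(0)=g'(0)$. Then $f(z)\equiv g(z)$.
   Context: For $\alpha,\gamma\in\mathbb{C}$ with $\gamma\neq 0,-1,-2,\cdots$, the confluent hypergeometric (Kummer) function is the entire function of $z$ given by ${}_{1}F_{1}(\alpha;\gamma;z):=\sum_{n=0}^{\infty}\frac{(\alpha)_{n}}{n!(\gamma)_{n}}z^{n}$, where $(\alpha)_0=1$ and $(\alpha)_{n}=\alpha(\alpha+1)\cdots(\alpha+n-1)$. For a meromorphic function $f$ and $a\in\mathbb{C}$, $E_{f}(a):=\{z\in\mathbb{C}:f(z)-a=0\}$ is the preimage of $a$ under $f$ counted with multiplicity (a zero of $f-a$ of multiplicity $m$ counts $m$ times), and $\overline{E}_{f}(a)$ is the set of distinct elements of $E_{f}(a)$. Two meromorphic functions $f$ and $g$ share the value $a$ CM (counting multiplicities) if $E_{f}(a)=E_{g}(a)$.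
   Formalization: The formal theorem additionally assumes that g is not identically a, which excludes only α = 0 with a = 1 (g ≡ 1), where the claim fails: f = exp(z²) satisfies every hypothesis but differs from g. *)

theory Defs
  imports "HOL-Complex_Analysis.Complex_Analysis"
begin

definition kummer :: "complex \<Rightarrow> complex \<Rightarrow> complex \<Rightarrow> complex" where
  "kummer \<alpha> \<gamma> z = (\<Sum>n. pochhammer \<alpha> n / (fact n * pochhammer \<gamma> n) * z ^ n)"

text \<open>
  The preimage of \<open>a\<close> under an entire function \<open>f\<close>, without and with multiplicity. The latter is
  a multiset of points that is in general infinite, so it is represented by its counting function,
  which is 0 off the preimage. The multiplicity is meaningful only if \<open>f\<close> is not identically \<open>a\<close>,
  since otherwise \<open>f - a\<close> has no order of vanishing. For the comparison function \<open>kummer \<alpha> \<gamma>\<close> this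
  excludes just \<open>\<alpha> = 0\<close>, \<open>a = 1\<close>, where uniqueness fails: \<open>exp (z\<^sup>2)\<close> and the constant 1 agree to first
  order at 0, have no zeros, and any preimage of 1 lies in that of the constant function.
\<close>

definition preimage :: "(complex \<Rightarrow> complex) \<Rightarrow> complex \<Rightarrow> complex set" where
  "preimage f a = {z. f z - a = 0}"

definition preimage_mult :: "(complex \<Rightarrow> complex) \<Rightarrow> complex \<Rightarrow> complex \<Rightarrow> nat" where
  "preimage_mult f a z = (if z \<in> preimage f a then nat (zorder (\<lambda>w. f w - a) z) else 0)"

definition share_CM :: "(complex \<Rightarrow> complex) \<Rightarrow> (complex \<Rightarrow> complex) \<Rightarrow> complex \<Rightarrow> bool" where
  "share_CM f g a \<longleftrightarrow> preimage_mult f a = preimage_mult g a"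

lemma preimage_eq_support:
  assumes "f holomorphic_on UNIV" and "\<exists>z. f z \<noteq> a"
  shows "preimage f a = {z. preimage_mult f a z > 0}"
proof -
  have "zorder (\<lambda>w. f w - a) z > 0" if "f z = a" for z
  proof -
    have hol: "(\<lambda>w. f w - a) holomorphic_on UNIV"
      by (intro holomorphic_intros assms)
    obtain b where "f b - a \<noteq> 0"
      using assms(2) by auto
    then have "\<forall>\<^sub>F w in at z. f w - a \<noteq> 0 \<and> w \<in> UNIV"
      using hol by (intro non_zero_neighbour_alt[where \<beta> = b]) auto
    then have "\<exists>\<^sub>F w in at z. f w - a \<noteq> 0"
      by (intro eventually_frequently) (auto elim: eventually_mono)
    then show ?thesis
      using zorder_pos_iff[OF hol] that by auto
  qed
  then show ?thesis
    by (auto simp: preimage_mult_def preimage_def)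
qed

end

theory Submission
  imports Defs "HOL-Real_Asymp.Real_Asymp"
begin

text \<open>
  Since \<open>f\<close> and \<open>g\<close> have the same zeros with the same multiplicities, \<open>f = g * exp h\<close> with an entire
  function \<open>h\<close>. The claim is that \<open>h\<close> is affine (\<open>exponent_affine\<close>). Given this, \<open>f 0 = g 0 = 1\<close> yields
  \<open>exp (h 0) = 1\<close>, and \<open>deriv f 0 = deriv g 0\<close> yields \<open>deriv h 0 = 0\<close>, so \<open>exp h\<close> is constantly 1.

  The Kummer function enters the proof as an entire function of exponential type with value 1 at 0.
  In the language of value distribution theory the reason is the second main theorem: \<open>f\<close>
  omits 0 and \<open>a\<close> except at the zeros of \<open>g\<close> and of \<open>w = g - a\<close>, of which there are only
  \<open>O(R)\<close> in the disc of radius \<open>R\<close>, so \<open>f\<close> itself is of exponential type up to logarithmic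
  corrections, and \<open>h\<close> grows more slowly than quadratically.

  The proof is a direct one that replaces integral means by the maximum principle on well chosen
  circles. Consider \<open>Q = w * (deriv f / (f - a))\<close>. A logarithmic derivative has only simple poles, and
  \<open>w\<close> vanishes at all of them, so \<open>Q\<close> is entire. On circles that keep away from the zeros of
  \<open>f - a\<close>, the logarithmic derivative is bounded by a power of the logarithm of the maximum modulus of
  \<open>f\<close> (\<open>logderiv_on_circle_le\<close>), that is, by a power of \<open>R + max |h|\<close>. Hence \<open>Q\<close> and, by
  distinguishing whether \<open>f\<close> is close to 0, also \<open>Q * exp (- h)\<close> are bounded by the exponential of
  \<open>O(R + log max |h|)\<close>. A holomorphic function that is not too small at the centre cannot satisfy
  both bounds unless \<open>h\<close> is \<open>O(R + log max |h|)\<close> itself on a smaller disc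
  (\<open>exponent_le_of_bounded_product\<close>). With Borel's growth lemma (\<open>growth_regularity\<close>), which chooses
  radii at which the larger and the smaller disc may be compared, this rules out growth of at least
  quadratic order.
\<close>

section \<open>Products over lists and logarithmic derivatives\<close>

lemma maximum_modulus_cball:
  fixes G :: "complex \<Rightarrow> complex"
  assumes "G holomorphic_on S" "cball 0 R \<subseteq> S" "\<And>z. norm z = R \<Longrightarrow> norm (G z) \<le> T" "norm z \<le> R"
  shows "norm (G z) \<le> T"
proof (rule maximum_modulus_frontier[of G "cball 0 R"])
  show "G holomorphic_on interior (cball 0 R)"
    using assms by (meson holomorphic_on_subset interior_subset)
  show "continuous_on (closure (cball 0 R)) G"
    using assms holomorphic_on_subset holomorphic_on_imp_continuous_on by auto
qed (use assms in \<open>auto simp: frontier_cball\<close>)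

lemma has_field_derivative_prod_list:
  fixes c :: "'b \<Rightarrow> complex \<Rightarrow> complex"
  assumes "\<And>p. p \<in> set ps \<Longrightarrow> (c p has_field_derivative c' p) (at z) \<and> c p z \<noteq> 0"
  shows "((\<lambda>z. \<Prod>p\<leftarrow>ps. c p z) has_field_derivative
           (\<Prod>p\<leftarrow>ps. c p z) * (\<Sum>p\<leftarrow>ps. c' p / c p z)) (at z)"
  using assms
proof (induction ps)
  case (Cons p ps)
  have "((\<lambda>z. c p z * (\<Prod>p\<leftarrow>ps. c p z)) has_field_derivative
      (c' p * (\<Prod>p\<leftarrow>ps. c p z) + ((\<Prod>p\<leftarrow>ps. c p z) * (\<Sum>p\<leftarrow>ps. c' p / c p z)) * c p z)) (at z)"
    using Cons by (intro DERIV_mult) auto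
  also have "c' p * (\<Prod>p\<leftarrow>ps. c p z) + ((\<Prod>p\<leftarrow>ps. c p z) * (\<Sum>p\<leftarrow>ps. c' p / c p z)) * c p z
      = (\<Prod>p\<leftarrow>p # ps. c p z) * (\<Sum>p\<leftarrow>p # ps. c' p / c p z)"
    using Cons by (simp add: field_simps)
  finally show ?case
    by simp
qed auto

lemma holomorphic_on_prod_list [holomorphic_intros]:
  assumes "\<And>p. p \<in> set ps \<Longrightarrow> c p holomorphic_on S"
  shows "(\<lambda>z. \<Prod>p\<leftarrow>ps. c p z :: complex) holomorphic_on S"
  using assms by (induction ps) (auto intro!: holomorphic_intros)

lemma holomorphic_on_sum_list [holomorphic_intros]:
  assumes "\<And>p. p \<in> set ps \<Longrightarrow> c p holomorphic_on S"
  shows "(\<lambda>z. \<Sum>p\<leftarrow>ps. c p z :: complex) holomorphic_on S"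
  using assms by (induction ps) (auto intro!: holomorphic_intros)

lemma norm_sum_list_le:
  assumes "\<And>p. p \<in> set ps \<Longrightarrow> norm (c p :: complex) \<le> B"
  shows "norm (\<Sum>p\<leftarrow>ps. c p) \<le> real (length ps) * B"
  using assms
proof (induction ps)
  case (Cons p ps)
  have "norm (c p + (\<Sum>p\<leftarrow>ps. c p)) \<le> norm (c p) + norm (\<Sum>p\<leftarrow>ps. c p)"
    by (rule norm_triangle_ineq)
  also have "\<dots> \<le> B + length ps * B"
    using Cons by (intro add_mono) auto
  finally show ?case
    by (simp add: algebra_simps)
qed auto

lemma logderiv_prod_list_mult:
  fixes c :: "'b \<Rightarrow> complex \<Rightarrow> complex"
  assumes c: "\<And>p. p \<in> set ps \<Longrightarrow> (c p has_field_derivative c' p) (at z) \<and> c p z \<noteq> 0"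
    and E: "E field_differentiable at z" "E z \<noteq> 0"
  shows "deriv (\<lambda>z. (\<Prod>p\<leftarrow>ps. c p z) * E z) z / ((\<Prod>p\<leftarrow>ps. c p z) * E z) =
           (\<Sum>p\<leftarrow>ps. c' p / c p z) + deriv E z / E z"
proof -
  have E': "(E has_field_derivative deriv E z) (at z)"
    using E by (simp add: DERIV_deriv_iff_field_differentiable)
  have "((\<lambda>z. \<Prod>p\<leftarrow>ps. c p z) has_field_derivative
      (\<Prod>p\<leftarrow>ps. c p z) * (\<Sum>p\<leftarrow>ps. c' p / c p z)) (at z)"
    using c by (rule has_field_derivative_prod_list)
  from DERIV_mult[OF this E']
  have "deriv (\<lambda>z. (\<Prod>p\<leftarrow>ps. c p z) * E z) z =
      (\<Prod>p\<leftarrow>ps. c p z) * (\<Sum>p\<leftarrow>ps. c' p / c p z) * E z + deriv E z * (\<Prod>p\<leftarrow>ps. c p z)"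
    by (rule DERIV_imp_deriv)
  moreover have "(\<Prod>p\<leftarrow>ps. c p z) \<noteq> 0"
    using c by (auto simp: prod_list_zero_iff)
  ultimately show ?thesis
    using E by (simp add: field_simps)
qed

section \<open>Removing zeros by reflection\<close>

text \<open>
  The finite Blaschke product with zeros \<open>ps\<close> for the disc of radius \<open>R\<close> is
  \<open>(\<Prod>p\<leftarrow>ps. z - p) / reflect R ps z\<close>. Only its denominator is named, because dividing a function by
  the Blaschke product amounts to dividing out its zeros and multiplying by this denominator.
\<close>
definition reflect :: "real \<Rightarrow> complex list \<Rightarrow> complex \<Rightarrow> complex" where
  "reflect R ps z = (\<Prod>p\<leftarrow>ps. (R\<^sup>2 - cnj p * z) / R)"

text \<open>
  On the circle \<open>norm z = R\<close> one has \<open>of_real R ^ 2 = z * cnj z\<close>, so each factor is \<open>z * cnj (z - p) / R\<close>.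
\<close>
lemma norm_reflect:
  assumes "norm z = R" "R > 0"
  shows "norm (reflect R ps z) = norm (\<Prod>p\<leftarrow>ps. z - p)"
proof -
  have "norm ((of_real R ^ 2 - cnj p * z) / R) = norm (z - p)" for p
  proof -
    have "of_real R ^ 2 - cnj p * z = z * cnj (z - p)"
      using assms complex_norm_square[of z] by (simp add: algebra_simps)
    then show ?thesis
      using assms by (simp add: norm_divide norm_mult del: complex_cnj_diff)
  qed
  then show ?thesis
    unfolding reflect_def by (induction ps) (simp_all only: list.map prod_list.Nil prod_list.Cons norm_mult)
qed

lemma norm_reflect_factor_ge:
  assumes "norm p \<le> R" "norm z \<le> R" "R > 0"
  shows "norm (R\<^sup>2 - cnj p * z) \<ge> R * (R - norm z)"
proof -
  have "norm (cnj p * z) \<le> R * norm z"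
    using assms by (auto simp: norm_mult intro: mult_right_mono)
  moreover have "norm (of_real (R\<^sup>2) :: complex) = R * R"
    by (simp add: power2_eq_square norm_mult)
  ultimately show ?thesis
    using norm_triangle_ineq2[of "of_real (R\<^sup>2)" "cnj p * z"] by (simp add: algebra_simps)
qed

lemma reflect_factor_nonzero:
  assumes "p \<in> cball 0 R" "norm z < R"
  shows "(of_real R)\<^sup>2 - cnj p * z \<noteq> 0"
proof -
  have R: "R > 0"
    using assms(2) norm_ge_zero[of z] by linarith
  then have "0 < R * (R - norm z)"
    using assms by simp
  also have "\<dots> \<le> norm ((of_real R)\<^sup>2 - cnj p * z)"
    using assms R by (intro norm_reflect_factor_ge) auto
  finally show ?thesis
    by auto
qed

lemma reflect_nonzero:
  assumes "set ps \<subseteq> cball 0 R" "norm z < R"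
  shows "reflect R ps z \<noteq> 0"
proof -
  have "R \<noteq> 0"
    using assms(2) norm_ge_zero[of z] by linarith
  moreover have "(of_real R)\<^sup>2 - cnj p * z \<noteq> 0" if "p \<in> set ps" for p
    using that assms by (intro reflect_factor_nonzero) auto
  ultimately show ?thesis
    by (auto simp: reflect_def prod_list_zero_iff)
qed

lemma holomorphic_reflect [holomorphic_intros]: "R > 0 \<Longrightarrow> reflect R ps holomorphic_on S"
  unfolding reflect_def by (intro holomorphic_intros) auto

text \<open>
  Replacing zeros by their reflections does not change the modulus on the circle, so the bound that
  holds for the original function there passes to the whole disc by the maximum principle.
\<close>
lemma norm_le_reflected:
  assumes E: "E holomorphic_on S" "cball 0 R \<subseteq> S" "R > 0"
    and T: "\<And>z. norm z = R \<Longrightarrow> norm ((\<Prod>p\<leftarrow>ps. z - p) * E z) \<le> T" and z: "norm z \<le> R"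
  shows "norm (E z * reflect R ps z) \<le> T"
proof (rule maximum_modulus_cball[of "\<lambda>z. E z * reflect R ps z" S R])
  show "(\<lambda>z. E z * reflect R ps z) holomorphic_on S"
    using E by (intro holomorphic_intros)
  show "norm (E w * reflect R ps w) \<le> T" if "norm w = R" for w
    using T[OF that] norm_reflect[OF that \<open>R > 0\<close>] by (simp add: norm_mult mult.commute)
qed (use E z in auto)

lemma norm_prod_list_minus_le:
  assumes "set ps \<subseteq> cball 0 \<rho>"
  shows "norm (\<Prod>p\<leftarrow>ps. 0 - p :: complex) \<le> \<rho> ^ length ps"
  using assms
proof (induction ps)
  case (Cons p ps)
  have "norm p * norm (\<Prod>p\<leftarrow>ps. 0 - p) \<le> \<rho> * \<rho> ^ length ps"
    using Cons by (intro mult_mono) (auto intro: order_trans[OF norm_ge_zero])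
  then show ?case
    by (simp add: norm_mult)
qed auto

lemma reflect_0: "R > 0 \<Longrightarrow> reflect R ps 0 = R ^ length ps"
  by (induction ps) (auto simp: reflect_def power2_eq_square)

text \<open>
  A Blaschke product is at most 1 in modulus inside the disc; the later estimates need this at the
  centre only, where the functions are known to be not too small.
\<close>
lemma norm_le_reflected_at_0:
  assumes "set ps \<subseteq> cball 0 R" "R > 0"
  shows "norm ((\<Prod>p\<leftarrow>ps. 0 - p) * E 0) \<le> norm (E 0 * reflect R ps 0)"
proof -
  have "norm ((\<Prod>p\<leftarrow>ps. 0 - p) * E 0) \<le> R ^ length ps * norm (E 0)"
    unfolding norm_mult by (intro mult_right_mono norm_prod_list_minus_le assms) auto
  also have "\<dots> = norm (E 0 * reflect R ps 0)"
    using assms by (simp add: reflect_0 norm_mult norm_power)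
  finally show ?thesis .
qed

text \<open>
  Jensen's bound for the number of zeros, in the multiplicative form that avoids logarithms and also
  holds when only some of the zeros have been divided out.
\<close>
lemma zero_count_le:
  assumes E: "E holomorphic_on S" "cball 0 R \<subseteq> S" and \<rho>: "0 < \<rho>" "\<rho> < R"
    and T: "\<And>z. norm z = R \<Longrightarrow> norm ((\<Prod>p\<leftarrow>ps. z - p) * E z) \<le> T" and ps: "set ps \<subseteq> cball 0 \<rho>"
  shows "(R / \<rho>) ^ length ps * norm ((\<Prod>p\<leftarrow>ps. 0 - p) * E 0) \<le> T"
proof -
  have "norm ((\<Prod>p\<leftarrow>ps. 0 - p) * E 0) \<le> \<rho> ^ length ps * norm (E 0)"
    unfolding norm_mult by (intro mult_right_mono norm_prod_list_minus_le ps) auto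
  then have "(R / \<rho>) ^ length ps * norm ((\<Prod>p\<leftarrow>ps. 0 - p) * E 0)
      \<le> (R / \<rho>) ^ length ps * (\<rho> ^ length ps * norm (E 0))"
    using \<rho> by (intro mult_left_mono) auto
  also have "\<dots> = norm (E 0 * reflect R ps 0)"
    using \<rho> by (simp add: reflect_0 norm_mult norm_power power_divide)
  also have "\<dots> \<le> T"
    using \<rho> by (intro norm_le_reflected[OF E _ T]) auto
  finally show ?thesis .
qed

text \<open>
  All zeros in the smaller disc, listed with multiplicity, are divided out. The process of splitting
  off one zero after the other stops because the zero count bounds the length of any list of zeros
  that divides \<open>F\<close>; a list of maximal length leaves a factor without zeros.
\<close>
lemma zero_removal:
  assumes F: "F holomorphic_on S" "open S" "cball 0 R \<subseteq> S" and \<rho>: "0 < \<rho>" "\<rho> < R"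
    and F0: "F 0 \<noteq> 0" and T: "\<And>z. norm z = R \<Longrightarrow> norm (F z) \<le> T"
  obtains ps E where "set ps \<subseteq> cball 0 \<rho>" "E holomorphic_on S"
    "\<And>z. z \<in> S \<Longrightarrow> F z = (\<Prod>p\<leftarrow>ps. z - p) * E z"
    "\<And>z. norm z \<le> \<rho> \<Longrightarrow> E z \<noteq> 0" "(R / \<rho>) ^ length ps * norm (F 0) \<le> T"
proof -
  define P where "P ps E \<longleftrightarrow> set ps \<subseteq> cball 0 \<rho> \<and> E holomorphic_on S \<and>
      (\<forall>z\<in>S. F z = (\<Prod>p\<leftarrow>ps. z - p) * E z)" for ps E
  have count: "(R / \<rho>) ^ length ps * norm (F 0) \<le> T" if "P ps E" for ps E
  proof -
    have eq: "(\<Prod>p\<leftarrow>ps. z - p) * E z = F z" if "norm z \<le> R" for z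
    proof -
      have "z \<in> S"
        using F(3) that by auto
      then show ?thesis
        using \<open>P ps E\<close> unfolding P_def by simp
    qed
    have "(R / \<rho>) ^ length ps * norm ((\<Prod>p\<leftarrow>ps. 0 - p) * E 0) \<le> T"
    proof (rule zero_count_le)
      show "norm ((\<Prod>p\<leftarrow>ps. z - p) * E z) \<le> T" if "norm z = R" for z
        using eq[of z] T[of z] that by simp
      show "E holomorphic_on S" "set ps \<subseteq> cball 0 \<rho>"
        using that unfolding P_def by blast+
    qed (use F \<rho> in auto)
    also have "(\<Prod>p\<leftarrow>ps. 0 - p) * E 0 = F 0"
      using \<rho> by (intro eq) auto
    finally show ?thesis .
  qed
  obtain N where N: "T / norm (F 0) < (R / \<rho>) ^ N"
    using real_arch_pow[of "R / \<rho>" "T / norm (F 0)"] \<rho> by auto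
  have bound: "length ps \<le> N" if "P ps E" for ps E
  proof (rule ccontr)
    assume "\<not> length ps \<le> N"
    then have "(R / \<rho>) ^ N \<le> (R / \<rho>) ^ length ps"
      using \<rho> by (intro power_increasing) auto
    with N have "T / norm (F 0) < (R / \<rho>) ^ length ps"
      by linarith
    with count[OF that] F0 show False
      by (simp add: field_simps)
  qed
  define Q where "Q n \<longleftrightarrow> (\<exists>ps E. P ps E \<and> length ps = n)" for n
  have "P [] F"
    using F(1) by (simp add: P_def)
  then have "Q 0"
    unfolding Q_def by force
  have le_N: "\<And>n. Q n \<Longrightarrow> n \<le> N"
    using bound unfolding Q_def by blast
  have "Q (Greatest Q)"
    using GreatestI_nat[of Q 0 N] \<open>Q 0\<close> le_N by blast
  have max: "\<And>n. Q n \<Longrightarrow> n \<le> Greatest Q"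
    by (rule Greatest_le_nat[of Q _ N]) (use le_N in auto)
  from \<open>Q (Greatest Q)\<close> obtain ps E where PE: "P ps E" "length ps = Greatest Q"
    unfolding Q_def by blast
  have "E z \<noteq> 0" if "norm z \<le> \<rho>" for z
  proof
    assume "E z = 0"
    define E' where "E' = (\<lambda>u. if u = z then deriv E z else (E u - E z) / (u - z))"
    have "E' holomorphic_on S"
      unfolding E'_def using PE(1) F(2) by (intro pole_lemma_open) (simp_all add: P_def)
    moreover have "E u = (u - z) * E' u" for u
      using \<open>E z = 0\<close> by (auto simp: E'_def)
    ultimately have "P (ps @ [z]) E'"
      using PE(1) that by (simp add: P_def mult.assoc)
    then have "Q (Suc (length ps))"
      unfolding Q_def by force
    with max PE show False
      by fastforce
  qed
  then show thesis
    using that[of ps E] PE(1) count[OF PE(1)] unfolding P_def by blast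
qed

section \<open>Holomorphic functions with bounded real part\<close>

text \<open>
  The map \<open>\<lambda>u. u / (2 * B - u)\<close> sends the half plane \<open>Re u < B\<close> to the unit disc and fixes 0, so the
  Schwarz lemma applies to its composition with \<open>u\<close>.
\<close>
lemma Borel_Caratheodory:
  assumes u: "u holomorphic_on ball 0 \<rho>" "u 0 = 0"
    and Re: "\<And>z. norm z < \<rho> \<Longrightarrow> Re (u z) < B" and z: "norm z < \<rho>"
  shows "norm (u z) \<le> 2 * B * norm z / (\<rho> - norm z)"
proof -
  have \<rho>: "\<rho> > 0"
    using z norm_ge_zero[of z] by linarith
  have B: "B > 0"
    using Re[of 0] u \<rho> by simp
  have nz: "2 * of_real B - u z \<noteq> 0" if "norm z < \<rho>" for z
    using Re[OF that] B by (auto simp: complex_eq_iff)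
  define \<phi> where "\<phi> = (\<lambda>z. u z / (2 * of_real B - u z))"
  define \<psi> where "\<psi> = (\<lambda>z. \<phi> (of_real \<rho> * z))"
  have \<phi>_less: "norm (\<phi> z) < 1" if "norm z < \<rho>" for z
  proof -
    have "0 < 4 * (B * (B - Re (u z)))"
      using Re[OF that] B by simp
    then have "(norm (u z))\<^sup>2 < (norm (2 * of_real B - u z))\<^sup>2"
      unfolding cmod_power2 by (simp add: power2_eq_square algebra_simps)
    then have "norm (u z) < norm (2 * of_real B - u z)"
      by (simp add: power2_less_imp_less)
    then show ?thesis
      using nz[OF that] by (simp add: \<phi>_def norm_divide)
  qed
  have hol\<phi>: "\<phi> holomorphic_on ball 0 \<rho>"
    unfolding \<phi>_def using u nz by (intro holomorphic_intros) auto
  have hol\<psi>: "\<psi> holomorphic_on ball 0 1"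
    unfolding \<psi>_def using \<rho>
    by (intro holomorphic_on_compose_gen[OF _ hol\<phi>, unfolded o_def] holomorphic_intros)
       (auto simp: norm_mult)
  have "norm (\<psi> (z / \<rho>)) \<le> norm (z / \<rho>)"
    using \<rho> z u \<phi>_less
    by (intro Schwarz_Lemma(1)[OF hol\<psi>]) (auto simp: \<psi>_def \<phi>_def norm_mult norm_divide)
  then have "norm (\<phi> z) \<le> norm z / \<rho>"
    using \<rho> by (simp add: \<psi>_def norm_divide)
  then have "norm (u z) * \<rho> \<le> norm z * norm (2 * of_real B - u z)"
    using \<rho> nz[OF z] by (simp add: \<phi>_def norm_divide field_simps)
  also have "\<dots> \<le> norm z * (2 * B + norm (u z))"
    using norm_triangle_ineq4[of "2 * of_real B" "u z"] B
    by (intro mult_left_mono) (auto simp: norm_mult)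
  finally have "norm (u z) * (\<rho> - norm z) \<le> 2 * B * norm z"
    by (simp add: algebra_simps)
  then show ?thesis
    using z by (simp add: field_simps)
qed

text \<open>
  \<open>G = exp k\<close> with the real part of \<open>k\<close> at most \<open>M\<close>, and at least \<open>-M\<close> at the centre. So
  \<open>Borel_Caratheodory\<close> bounds \<open>k\<close>, and Cauchy's inequality bounds \<open>deriv k\<close>, which is the logarithmic
  derivative of \<open>G\<close>.
\<close>
lemma logderiv_zero_free_le:
  assumes G: "G holomorphic_on ball 0 \<rho>" "\<And>z. norm z < \<rho> \<Longrightarrow> G z \<noteq> 0"
    and up: "\<And>z. norm z < \<rho> \<Longrightarrow> norm (G z) \<le> exp M" and lo: "norm (G 0) \<ge> exp (-M)"
    and M: "M > 0" and z: "norm z < \<rho>"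
  shows "norm (deriv G z / G z) \<le> 24 * M * \<rho> / (\<rho> - norm z)\<^sup>2"
proof -
  define d where "d = (\<rho> - norm z) / 2"
  have d: "d > 0" and \<rho>: "\<rho> > 0"
    using z norm_ge_zero[of z] by (auto simp: d_def simp del: norm_ge_zero)
  have d2: "norm z = \<rho> - 2 * d"
    by (simp add: d_def field_simps)
  obtain k where k: "k holomorphic_on ball 0 \<rho>" "\<And>z. norm z < \<rho> \<Longrightarrow> G z = exp (k z)"
    using contractible_imp_holomorphic_log[of G "ball 0 \<rho>"] G convex_imp_contractible[of "ball 0 \<rho>"]
    by (auto simp: dist_norm)
  have Re_k: "Re (k w) \<le> M" if "norm w < \<rho>" for w
    using up[OF that] k(2)[OF that] by simp
  have Re_k0: "Re (k 0) \<ge> -M"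
    using lo k(2)[of 0] \<rho> by simp
  define u where "u = (\<lambda>w. k w - k 0)"
  have u_le: "norm (u w) \<le> 6 * M * \<rho> / d" if "norm w \<le> \<rho> - d" for w
  proof -
    have "norm (u w) \<le> 2 * (3 * M) * norm w / (\<rho> - norm w)"
    proof (rule Borel_Caratheodory)
      show "Re (u w) < 3 * M" if "norm w < \<rho>" for w
        using Re_k[OF that] Re_k0 M by (simp add: u_def)
    qed (use k that d in \<open>auto simp: u_def intro!: holomorphic_intros\<close>)
    also have "\<dots> \<le> 2 * (3 * M) * \<rho> / d"
      using that d M \<rho> by (intro frac_le mult_left_mono) auto
    finally show ?thesis
      by simp
  qed
  have sub: "cball z d \<subseteq> ball 0 \<rho>"
  proof
    fix w assume "w \<in> cball z d"
    then have "norm w \<le> norm z + d"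
      using norm_triangle_ineq[of z "w - z"] by (simp add: dist_norm norm_minus_commute)
    then show "w \<in> ball 0 \<rho>"
      using d d2 by simp
  qed
  have holu: "u holomorphic_on ball 0 \<rho>"
    unfolding u_def using k by (intro holomorphic_intros)
  have "norm ((deriv ^^ 1) u z) \<le> fact 1 * (6 * M * \<rho> / d) / d ^ 1"
  proof (rule Cauchy_inequality)
    have "u holomorphic_on cball z d"
      using sub holu holomorphic_on_subset by blast
    then show "u holomorphic_on ball z d" "continuous_on (cball z d) u"
      using ball_subset_cball holomorphic_on_subset holomorphic_on_imp_continuous_on by blast+
    show "norm (u x) \<le> 6 * M * \<rho> / d" if "norm (z - x) = d" for x
    proof (rule u_le)
      show "norm x \<le> \<rho> - d"
        using norm_triangle_ineq4[of z "z - x"] that d2 by simp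
    qed
  qed (use d in auto)
  then have 1: "norm (deriv u z) \<le> 6 * M * \<rho> / d / d"
    by simp
  have "(k has_field_derivative deriv k z) (at z)"
    using k z by (auto intro: holomorphic_derivI)
  then have "((\<lambda>w. exp (k w)) has_field_derivative deriv k z * exp (k z)) (at z)" 
        and 2: "(u has_field_derivative deriv k z) (at z)"
    unfolding u_def by (auto intro!: derivative_eq_intros)
  then have "(G has_field_derivative deriv k z * exp (k z)) (at z)"
    by (rule_tac has_field_derivative_transform_within_open[of _ _ _ "ball 0 \<rho>"]) (use z k in auto)
  then have "deriv G z / G z = deriv u z"
    using k(2)[OF z] DERIV_imp_deriv[OF 2] by (simp add: DERIV_imp_deriv)
  with 1 have "norm (deriv G z / G z) \<le> 6 * M * \<rho> / d / d"
    by simp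
  also have "\<dots> = 24 * M * \<rho> / (\<rho> - norm z)\<^sup>2"
    by (simp add: d_def power2_eq_square)
  finally show ?thesis .
qed

section \<open>The logarithmic derivative on circles\<close>

text \<open>
  Among \<open>length ps + 1\<close> equally spaced radii, each point of \<open>ps\<close> can be close to at most one.
\<close>
lemma radius_avoiding_moduli:
  fixes ps :: "complex list"
  assumes "a < b"
  obtains r where "a \<le> r" "r \<le> b" "\<And>p. p \<in> set ps \<Longrightarrow> (b - a) / (2 * (length ps + 1)) \<le> \<bar>r - norm p\<bar>"
proof -
  define d where "d = (b - a) / (length ps + 1)"
  have d: "d > 0" "(b - a) / (2 * (length ps + 1)) = d / 2" "length ps * d \<le> b - a"
    using assms by (auto simp: d_def field_simps)
  define r where "r = (\<lambda>i::nat. a + i * d)"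
  have "\<exists>i\<le>length ps. \<forall>p\<in>set ps. d / 2 \<le> \<bar>r i - norm p\<bar>"
  proof (rule ccontr)
    assume "\<not> ?thesis"
    then obtain p where p: "\<And>i. i \<le> length ps \<Longrightarrow> p i \<in> set ps \<and> \<bar>r i - norm (p i)\<bar> < d / 2"
      by (metis not_le)
    have "inj_on p {..length ps}"
    proof (rule inj_onI, rule ccontr)
      fix i j assume ij: "i \<in> {..length ps}" "j \<in> {..length ps}" "p i = p j" "i \<noteq> j"
      have "\<bar>r i - norm (p j)\<bar> < d / 2" "\<bar>r j - norm (p j)\<bar> < d / 2"
        using p[of i] p[of j] ij by auto
      then have "\<bar>r i - r j\<bar> < d"
        by linarith
      moreover have "r i - r j = (real i - real j) * d"
        by (simp add: r_def algebra_simps)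
      then have "\<bar>r i - r j\<bar> = \<bar>real i - real j\<bar> * d"
        using d by (simp add: abs_mult)
      moreover have "1 \<le> \<bar>real i - real j\<bar>"
        using \<open>i \<noteq> j\<close> by linarith
      ultimately show False
        using d mult_right_mono[of 1 "\<bar>real i - real j\<bar>" d] by simp
    qed
    then have "card {..length ps} \<le> card (set ps)"
      by (rule card_inj_on_le) (use p in auto)
    then show False
      using card_length[of ps] by simp
  qed
  then obtain i where i: "i \<le> length ps" "\<forall>p\<in>set ps. d / 2 \<le> \<bar>r i - norm p\<bar>"
    by blast
  show thesis
  proof (rule that[of "r i"])
    show "a \<le> r i"
      using d by (simp add: r_def)
    have "i * d \<le> length ps * d"
      using i d by (intro mult_right_mono) auto
    then show "r i \<le> b"
      using d(3) by (simp add: r_def)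
    show "(b - a) / (2 * (length ps + 1)) \<le> \<bar>r i - norm p\<bar>" if "p \<in> set ps" for p
      using i(2) that unfolding d(2) by blast
  qed
qed

text \<open>
  A pointwise form of the lemma on the logarithmic derivative. An arbitrarily large logarithmic
  derivative is possible only near zeros, hence the bound is on a circle that keeps away from them. What
  matters is that it is polynomial in \<open>M\<close>, the order of magnitude of the logarithm of \<open>F\<close>: its own
  logarithm is then negligible compared with \<open>M\<close>. The factorization is part of the conclusion
  because it is used again to cancel the poles of the logarithmic derivative.
\<close>
lemma logderiv_on_circle_le:
  assumes F: "F holomorphic_on UNIV" and \<eta>: "0 < \<eta>" "\<eta> \<le> 1" and M: "1 \<le> M"
    and up: "\<And>z. norm z = 1 + \<eta> \<Longrightarrow> norm (F z) \<le> exp M" and lo: "exp (-M) \<le> norm (F 0)"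
  obtains r ps E where "1 + \<eta>/4 \<le> r" "r \<le> 1 + \<eta>/2" "E holomorphic_on UNIV"
    "\<And>z. F z = (\<Prod>p\<leftarrow>ps. z - p) * E z" "\<And>z. norm z \<le> 1 + 3*\<eta>/4 \<Longrightarrow> E z \<noteq> 0"
    "\<And>z. norm z = r \<Longrightarrow> F z \<noteq> 0 \<and> norm (deriv F z / F z) \<le> 3000 * M\<^sup>2 / \<eta>^3"
proof -
  define R \<rho> where "R = 1 + \<eta>" and "\<rho> = 1 + 3*\<eta>/4"
  have R: "0 < \<rho>" "\<rho> < R" "R > 0"
    using \<eta> by (auto simp: R_def \<rho>_def)
  have F0: "F 0 \<noteq> 0"
    using lo by auto
  have up': "norm (F z) \<le> exp M" if "norm z = R" for z
    using up that by (simp add: R_def)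
  have "\<exists>ps E. set ps \<subseteq> cball 0 \<rho> \<and> E holomorphic_on UNIV \<and> (\<forall>z. F z = (\<Prod>p\<leftarrow>ps. z - p) * E z) \<and>
      (\<forall>z. norm z \<le> \<rho> \<longrightarrow> E z \<noteq> 0) \<and> (R / \<rho>) ^ length ps * norm (F 0) \<le> exp M"
  proof (rule zero_removal[OF F open_UNIV subset_UNIV R(1,2) F0 up'], assumption)
    fix ps E
    assume *: "set ps \<subseteq> cball 0 \<rho>" "E holomorphic_on UNIV"
      "\<And>z. z \<in> UNIV \<Longrightarrow> F z = (\<Prod>p\<leftarrow>ps. z - p) * E z"
      "\<And>z. norm z \<le> \<rho> \<Longrightarrow> E z \<noteq> 0" "(R / \<rho>) ^ length ps * norm (F 0) \<le> exp M"
    show ?thesis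
      by (intro exI[of _ ps] exI[of _ E] conjI allI impI *) auto
  qed
  then obtain ps E where ps: "set ps \<subseteq> cball 0 \<rho>" and E: "E holomorphic_on UNIV"
    and eq: "\<And>z. F z = (\<Prod>p\<leftarrow>ps. z - p) * E z" and nz: "\<And>z. norm z \<le> \<rho> \<Longrightarrow> E z \<noteq> 0"
    and count: "(R / \<rho>) ^ length ps * norm (F 0) \<le> exp M"
    by blast
  define n where "n = length ps"
  (* The count gives (R / \<rho>) ^ n \<le> exp (2 * M), and R / \<rho> is at least exp (\<eta>/8). *)
  have n_le: "n \<le> 16 * M / \<eta>"
  proof -
    have "exp (\<eta>/8) \<le> 1 + \<eta>/8 + (\<eta>/8)\<^sup>2"
      using \<eta> by (intro exp_bound) auto
    also have "\<dots> \<le> 1 + \<eta>/7"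
    proof -
      have "\<eta>\<^sup>2 \<le> \<eta>"
        using \<eta> by (simp add: power2_eq_square mult_left_le)
      then show ?thesis
        using \<eta> by (simp add: power_divide)
    qed
    also have "\<dots> \<le> R / \<rho>"
    proof -
      have "\<eta> * \<eta> \<le> \<eta>"
        using \<eta> by (simp add: mult_left_le)
      then have "(1 + \<eta>/7) * \<rho> \<le> R"
        using \<eta> by (simp add: R_def \<rho>_def field_simps)
      then show ?thesis
        using R by (simp add: pos_le_divide_eq)
    qed
    finally have "exp (\<eta>/8) ^ n \<le> (R / \<rho>) ^ n"
      by (rule power_mono) auto
    then have "exp (n * (\<eta>/8)) * exp (-M) \<le> (R / \<rho>) ^ n * norm (F 0)"
      using lo R unfolding exp_of_nat_mult by (intro mult_mono) auto
    also have "\<dots> \<le> exp M"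
      using count by (simp add: n_def)
    finally have "exp (n * (\<eta>/8) + - M) \<le> exp M"
      by (simp only: exp_add)
    then have "n * (\<eta>/8) \<le> 2 * M"
      by simp
    then show ?thesis
      using \<eta> by (simp add: field_simps)
  qed
  have n1_le: "n + 1 \<le> 17 * M / \<eta>"
  proof -
    have "1 \<le> M / \<eta>"
      using \<eta> M by (simp add: field_simps)
    then show ?thesis
      using n_le by simp
  qed
  obtain r where r: "1 + \<eta>/4 \<le> r" "r \<le> 1 + \<eta>/2"
    "\<And>p. p \<in> set ps \<Longrightarrow> (\<eta>/4) / (2 * (length ps + 1)) \<le> \<bar>r - norm p\<bar>"
    using radius_avoiding_moduli[of "1 + \<eta>/4" "1 + \<eta>/2" ps] \<eta> by auto
  define \<delta> where "\<delta> = (\<eta>/4) / (2 * (length ps + 1))"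
  have \<delta>: "\<delta> > 0"
    using \<eta> by (simp add: \<delta>_def)
  have r_less: "r < \<rho>" "r < R"
    using r \<eta> R by (auto simp: \<rho>_def)
  define G where "G = (\<lambda>z. reflect R ps z * E z)"
  have psR: "set ps \<subseteq> cball 0 R"
    using ps R by auto
  have reflect_nz: "(of_real R)\<^sup>2 - cnj p * z \<noteq> 0" if "p \<in> set ps" "norm z < R" for p z
    using that psR by (intro reflect_factor_nonzero) auto
  have G_nz: "G z \<noteq> 0" if "norm z < \<rho>" for z
    using that nz[of z] R psR by (auto simp: G_def reflect_nonzero)
  have G_le: "norm (G z) \<le> exp M" if "norm z < \<rho>" for z
    using norm_le_reflected[OF E, of R ps "exp M" z] up R that unfolding G_def R_def eq[symmetric]
    by (simp add: mult.commute)
  have G_0: "exp (-M) \<le> norm (G 0)"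
  proof -
    have "exp (-M) \<le> norm (F 0)"
      by (fact lo)
    also have "\<dots> \<le> norm (G 0)"
      using norm_le_reflected_at_0[OF psR R(3), of E] by (simp add: G_def eq mult.commute)
    finally show ?thesis .
  qed
  have main: "F z \<noteq> 0 \<and> norm (deriv F z / F z) \<le> 3000 * M\<^sup>2 / \<eta>^3" if z: "norm z = r" for z
  proof -
    have dist: "\<delta> \<le> norm (z - p)" if "p \<in> set ps" for p
      using r(3)[OF that] norm_triangle_ineq3[of z p] z by (simp add: \<delta>_def)
    have Ed: "E field_differentiable at z"
      using E by (simp add: holomorphic_on_imp_differentiable_at)
    have Ez: "E z \<noteq> 0"
      using nz z r_less by auto
    have p_nz: "z - p \<noteq> 0" if "p \<in> set ps" for p
      using dist[OF that] \<delta> by auto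
    have "deriv F z / F z = (\<Sum>p\<leftarrow>ps. 1 / (z - p)) + deriv E z / E z"
      unfolding eq[abs_def] using p_nz
      by (intro logderiv_prod_list_mult[OF _ Ed Ez]) (auto intro!: derivative_eq_intros)
    moreover have "deriv G z / G z = (\<Sum>p\<leftarrow>ps. (- cnj p / R) / (((of_real R)\<^sup>2 - cnj p * z) / R)) + deriv E z / E z"
      unfolding G_def reflect_def using R reflect_nz[of _ z] z r_less
      by (intro logderiv_prod_list_mult[OF _ Ed Ez]) (auto intro!: derivative_eq_intros)
    ultimately have split: "deriv F z / F z = (\<Sum>p\<leftarrow>ps. 1 / (z - p)) + deriv G z / G z
        - (\<Sum>p\<leftarrow>ps. (- cnj p / R) / (((of_real R)\<^sup>2 - cnj p * z) / R))"
      by simp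
    have M2: "M / \<eta>\<^sup>2 \<le> M\<^sup>2 / \<eta> ^ 3"
    proof (rule frac_le)
      show "M \<le> M\<^sup>2"
        using M by (simp add: power2_eq_square)
      show "\<eta> ^ 3 \<le> \<eta>\<^sup>2"
        using \<eta> by (intro power_decreasing) auto
    qed (use \<eta> M in auto)
    (* The zeros themselves: each term is at most 1 / \<delta>, which is of order n / \<eta>. *)
    have 1: "norm (\<Sum>p\<leftarrow>ps. 1 / (z - p)) \<le> 2176 * (M\<^sup>2 / \<eta> ^ 3)"
    proof -
      have "norm (\<Sum>p\<leftarrow>ps. 1 / (z - p)) \<le> n * (1 / \<delta>)"
        unfolding n_def
      proof (rule norm_sum_list_le)
        show "norm (1 / (z - p)) \<le> 1 / \<delta>" if "p \<in> set ps" for p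
          using dist[OF that] \<delta> unfolding norm_divide norm_one by (intro frac_le) auto
      qed
      also have "1 / \<delta> = 8 * (n + 1) / \<eta>"
        using \<eta> by (simp add: \<delta>_def n_def)
      also have "n * (8 * (n + 1) / \<eta>) \<le> (16 * M / \<eta>) * (8 * (17 * M / \<eta>) / \<eta>)"
        using n_le n1_le \<eta> M by (intro mult_mono divide_right_mono) auto
      also have "\<dots> = 2176 * (M\<^sup>2 / \<eta> ^ 3)"
        by (simp add: power2_eq_square power3_eq_cube)
      finally show ?thesis .
    qed
    have 2: "norm (deriv G z / G z) \<le> 672 * (M / \<eta>\<^sup>2)"
    proof -
      have "norm (deriv G z / G z) \<le> 24 * M * \<rho> / (\<rho> - norm z)\<^sup>2"
      proof (rule logderiv_zero_free_le)
        show "G holomorphic_on ball 0 \<rho>"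
          unfolding G_def using E R by (intro holomorphic_intros) (auto intro: holomorphic_on_subset)
      qed (use G_nz G_le G_0 M z r_less in auto)
      also have "\<dots> \<le> 24 * M * (7/4) / (\<eta>/4)\<^sup>2"
        using M \<eta> r z by (intro frac_le mult_left_mono power_mono) (auto simp: \<rho>_def)
      also have "\<dots> = 672 * (M / \<eta>\<^sup>2)"
        by (simp add: power_divide)
      finally show ?thesis .
    qed
    (* The reflected zeros lie outside the disc of radius R, hence at distance at least \<eta>/2 from the circle. *)
    have 3: "norm (\<Sum>p\<leftarrow>ps. (- cnj p / R) / (((of_real R)\<^sup>2 - cnj p * z) / R)) \<le> 32 * (M / \<eta>\<^sup>2)"
    proof -
      have "norm ((- cnj p / R) / (((of_real R)\<^sup>2 - cnj p * z) / R)) \<le> 2 / \<eta>" if "p \<in> set ps" for p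
      proof -
        have p: "norm p \<le> R"
          using that ps R by auto
        have "norm ((- cnj p / R) / (((of_real R)\<^sup>2 - cnj p * z) / R)) = norm p / norm ((of_real R)\<^sup>2 - cnj p * z)"
          using R by (simp add: norm_divide)
        also have "\<dots> \<le> R / (R * (R - norm z))"
          using p R z r_less by (intro frac_le norm_reflect_factor_ge) auto
        also have "\<dots> = 1 / (R - r)"
          using R z by simp
        also have "\<dots> \<le> 1 / (\<eta>/2)"
          using r \<eta> by (intro divide_left_mono) (auto simp: R_def)
        finally show ?thesis
          by simp
      qed
      then have "norm (\<Sum>p\<leftarrow>ps. (- cnj p / R) / (((of_real R)\<^sup>2 - cnj p * z) / R)) \<le> n * (2 / \<eta>)"
        unfolding n_def by (intro norm_sum_list_le)
      also have "\<dots> \<le> (16 * M / \<eta>) * (2 / \<eta>)"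
        using n_le \<eta> by (intro mult_right_mono) auto
      also have "\<dots> = 32 * (M / \<eta>\<^sup>2)"
        by (simp add: power2_eq_square)
      finally show ?thesis .
    qed
    have "norm (deriv F z / F z) \<le> 2176 * (M\<^sup>2 / \<eta> ^ 3) + 672 * (M / \<eta>\<^sup>2) + 32 * (M / \<eta>\<^sup>2)"
      unfolding split using 1 2 3
      by (intro order.trans[OF norm_triangle_ineq4] add_mono order.trans[OF norm_triangle_ineq]) auto
    also have "\<dots> \<le> 3000 * (M\<^sup>2 / \<eta> ^ 3)"
    proof -
      have "0 \<le> M\<^sup>2 / \<eta> ^ 3"
        using \<eta> by simp
      then show ?thesis
        using M2 by linarith
    qed
    finally have "norm (deriv F z / F z) \<le> 3000 * M\<^sup>2 / \<eta> ^ 3"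
      by simp
    moreover have "F z \<noteq> 0"
      unfolding eq using Ez p_nz by (auto simp: prod_list_zero_iff)
    ultimately show ?thesis
      by blast
  qed
  show thesis
    by (rule that[OF r(1,2) E eq _ main]) (use nz in \<open>auto simp: \<rho>_def\<close>)
qed

text \<open>
  The poles of a logarithmic derivative are simple, whatever the multiplicities of the zeros. So a
  function \<open>w\<close> that vanishes at the zeros of \<open>F\<close>, possibly only to first order, cancels all of them. This
  is why the hypothesis on the value \<open>a\<close> can ignore multiplicities.
\<close>
lemma logderiv_times_holomorphic_extension:
  assumes E: "E holomorphic_on UNIV" and eq: "\<And>z. F z = (\<Prod>p\<leftarrow>ps. z - p) * E z"
    and nz: "\<And>z. z \<in> S \<Longrightarrow> E z \<noteq> 0" and S: "open S"
    and w: "w holomorphic_on UNIV" "\<And>z. F z = 0 \<Longrightarrow> w z = 0"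
  obtains Q where "Q holomorphic_on S" "\<And>z. z \<in> S \<Longrightarrow> F z \<noteq> 0 \<Longrightarrow> Q z = w z * (deriv F z / F z)"
proof
  define v where "v = (\<lambda>p z. if z = p then deriv w p else (w z - w p) / (z - p))"
  define Q where "Q = (\<lambda>z. (\<Sum>p\<leftarrow>ps. v p z) + w z * (deriv E z / E z))"
  have "v p holomorphic_on UNIV" for p
    unfolding v_def by (intro pole_lemma_open w) auto
  then have "v p holomorphic_on S" for p
    by (rule holomorphic_on_subset) auto
  moreover have "deriv E holomorphic_on S" "E holomorphic_on S" "w holomorphic_on S"
    using holomorphic_deriv[OF E] E w by (auto intro: holomorphic_on_subset)
  ultimately show "Q holomorphic_on S"
    unfolding Q_def by (intro holomorphic_intros) (use nz S in auto)
  show "Q z = w z * (deriv F z / F z)" if z: "z \<in> S" "F z \<noteq> 0" for z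
  proof -
    have p: "z - p \<noteq> 0" "w p = 0" if "p \<in> set ps" for p
      using that z w(2)[of p] eq by (auto simp: prod_list_zero_iff)
    have "deriv F z / F z = (\<Sum>p\<leftarrow>ps. 1 / (z - p)) + deriv E z / E z"
      unfolding eq[abs_def] using p nz z E
      by (intro logderiv_prod_list_mult)
         (auto intro!: derivative_eq_intros simp: holomorphic_on_imp_differentiable_at)
    moreover have "w z * (\<Sum>p\<leftarrow>ps. 1 / (z - p)) = (\<Sum>p\<leftarrow>ps. v p z)"
    proof -
      have "(\<Sum>p\<leftarrow>ps. v p z) = (\<Sum>p\<leftarrow>ps. w z * (1 / (z - p)))"
        using p by (intro arg_cong[of _ _ sum_list] map_cong) (auto simp: v_def)
      then show ?thesis
        by (simp only: sum_list_const_mult)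
    qed
    ultimately show ?thesis
      by (simp add: Q_def algebra_simps)
  qed
qed

section \<open>A self-improving bound for the exponent\<close>

text \<open>
  If \<open>Q\<close> had no zeros, \<open>Q = exp l\<close>, the two bounds would say that the harmonic functions \<open>Re l\<close> and
  \<open>Re (l + h)\<close> are at most \<open>ln B\<close>. They are at least \<open>- ln B\<close> at the centre, so \<open>Borel_Caratheodory\<close> bounds
  both, and with them the difference \<open>h\<close>. Zeros of \<open>Q\<close> are replaced by their reflections,
  which preserves the bounds and does not decrease \<open>norm (Q 0)\<close>.
\<close>
lemma exponent_le_of_bounded_product:
  assumes Q: "Q holomorphic_on S" and h: "h holomorphic_on S" "h 0 = 0"
    and S: "open S" "cball 0 R \<subseteq> S" and \<rho>: "0 < \<rho>" "\<rho> < R" and B: "B > 1"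
    and le: "\<And>z. norm z = R \<Longrightarrow> norm (Q z) \<le> B"
    and le_exp: "\<And>z. norm z = R \<Longrightarrow> norm (Q z * exp (h z)) \<le> B"
    and lo: "1 / B \<le> norm (Q 0)" and z: "norm z < \<rho>"
  shows "norm (h z) \<le> 12 * ln B * norm z / (\<rho> - norm z)"
proof -
  define s where "s = ln B"
  have s: "s > 0" "exp s = B"
    using B by (auto simp: s_def)
  have "Q 0 \<noteq> 0"
    using lo B by (auto simp: field_simps)
  then obtain ps E where ps: "set ps \<subseteq> cball 0 \<rho>" and E: "E holomorphic_on S"
    and eq: "\<And>z. z \<in> S \<Longrightarrow> Q z = (\<Prod>p\<leftarrow>ps. z - p) * E z"
    and nz: "\<And>z. norm z \<le> \<rho> \<Longrightarrow> E z \<noteq> 0"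
    by (rule zero_removal[OF Q S \<rho> _ le]) auto
  have R: "R > 0"
    using \<rho> by simp
  have psR: "set ps \<subseteq> cball 0 R"
    using ps \<rho> by auto
  have sphere: "z \<in> S" if "norm z = R" for z
    using S that by auto
  define G where "G = (\<lambda>z. E z * reflect R ps z)"
  have G_hol: "G holomorphic_on ball 0 \<rho>"
    unfolding G_def using E R S \<rho> by (intro holomorphic_intros) (auto elim!: holomorphic_on_subset)
  have h_hol: "h holomorphic_on ball 0 \<rho>"
    using S \<rho> by (intro holomorphic_on_subset[OF h(1)]) auto
  have G_nz: "G z \<noteq> 0" if "z \<in> ball 0 \<rho>" for z
    using that nz[of z] \<rho> psR by (auto simp: G_def reflect_nonzero)
  obtain l where l: "l holomorphic_on ball 0 \<rho>" "\<And>z. z \<in> ball 0 \<rho> \<Longrightarrow> G z = exp (l z)"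
    using contractible_imp_holomorphic_log[OF G_hol convex_imp_contractible[OF convex_ball] G_nz] by blast
  have Re_l: "Re (l z) \<le> s" if "norm z < \<rho>" for z
  proof -
    have "norm (G z) \<le> B"
      unfolding G_def
    proof (rule norm_le_reflected[OF E S(2) R])
      show "norm ((\<Prod>p\<leftarrow>ps. z - p) * E z) \<le> B" if "norm z = R" for z
        using le[OF that] eq[OF sphere[OF that]] by simp
    qed (use that \<rho> in auto)
    then have "exp (Re (l z)) \<le> exp s"
      using l(2)[of z] that s by simp
    then show ?thesis
      by simp
  qed
  have Re_lh: "Re (l z) + Re (h z) \<le> s" if "norm z < \<rho>" for z
  proof -
    have "norm ((E z * exp (h z)) * reflect R ps z) \<le> B"
    proof (rule norm_le_reflected[OF _ S(2) R])
      show "(\<lambda>z. E z * exp (h z)) holomorphic_on S"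
        using E h by (intro holomorphic_intros)
      show "norm ((\<Prod>p\<leftarrow>ps. z - p) * (E z * exp (h z))) \<le> B" if "norm z = R" for z
        using le_exp[OF that] eq[OF sphere[OF that]] by (simp add: mult.assoc)
    qed (use that \<rho> in auto)
    also have "(E z * exp (h z)) * reflect R ps z = exp (l z + h z)"
      using l(2)[of z] that by (simp add: G_def exp_add mult_ac)
    finally have "exp (Re (l z + h z)) \<le> exp s"
      using s by simp
    then show ?thesis
      by simp
  qed
  have Re_l0: "Re (l 0) \<ge> -s"
  proof -
    have "exp (-s) = 1 / B"
      using s by (simp add: exp_minus field_simps)
    also have "\<dots> \<le> norm (Q 0)"
      by (fact lo)
    also have "\<dots> \<le> norm (G 0)"
    proof -
      have "0 \<in> S"
        using S(2) R by (intro subsetD[OF S(2)]) simp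
      then show ?thesis
        unfolding G_def using norm_le_reflected_at_0[OF psR R, of E] eq[of 0] by simp
    qed
    also have "\<dots> = exp (Re (l 0))"
      using l(2)[of 0] \<rho> by simp
    finally show ?thesis
      by simp
  qed
  have 1: "norm (l z - l 0) \<le> 2 * (3 * s) * norm z / (\<rho> - norm z)"
  proof (rule Borel_Caratheodory[OF _ _ _ z])
    show "Re (l w - l 0) < 3 * s" if "norm w < \<rho>" for w
      using Re_l[OF that] Re_l0 s by simp
  qed (use l in \<open>auto intro!: holomorphic_intros\<close>)
  have 2: "norm (l z + h z - l 0) \<le> 2 * (3 * s) * norm z / (\<rho> - norm z)"
  proof (rule Borel_Caratheodory[OF _ _ _ z])
    show "Re (l w + h w - l 0) < 3 * s" if "norm w < \<rho>" for w
      using Re_lh[OF that] Re_l0 s by simp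
  qed (use l h h_hol in \<open>auto intro!: holomorphic_intros\<close>)
  have "norm (h z) \<le> norm (l z + h z - l 0) + norm (l z - l 0)"
    using norm_triangle_ineq4[of "l z + h z - l 0" "l z - l 0"] by simp
  with 1 2 show ?thesis
    by (simp add: s_def)
qed

lemma norm_deriv_le_of_bound:
  assumes "f holomorphic_on UNIV" "d > 0" "norm z + d \<le> R" "\<And>z. norm z \<le> R \<Longrightarrow> norm (f z) \<le> B"
  shows "norm (deriv f z) \<le> B / d"
proof -
  have "norm ((deriv ^^ 1) f z) \<le> fact 1 * B / d ^ 1"
  proof (rule Cauchy_inequality)
    show "norm (f x) \<le> B" if "norm (z - x) = d" for x
      using norm_triangle_ineq4[of z "z - x"] that assms by simp
    show "f holomorphic_on ball z d" "continuous_on (cball z d) f"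
      using assms(1) holomorphic_on_subset holomorphic_on_imp_continuous_on by blast+
  qed (use assms in auto)
  then show ?thesis
    by simp
qed

text \<open>
  The heart of the proof: \<open>Y\<close>, an a priori bound for \<open>h\<close> on a slightly larger disc, enters the bound for
  \<open>h\<close> only through its logarithm, while \<open>X\<close> measures \<open>g\<close> and \<open>w\<close>. Call a quantity moderate if it is at
  most the exponential of a multiple of \<open>X + ln Y + ln (1 / \<eta>)\<close>. Put \<open>F = f - a\<close> and
  \<open>Q = w * (deriv F / F)\<close>, which is holomorphic because \<open>w\<close> cancels the poles. On a good circle \<open>Q\<close> is
  moderate since the logarithmic derivative is. But \<open>Q * exp (- h)\<close> is moderate as well: if
  \<open>norm (f z) > norm a / 2\<close>, then \<open>exp (- h) = g / f\<close> is moderate at \<open>z\<close>; otherwise \<open>norm (F z)\<close> is at least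
  \<open>norm a / 2\<close>, and \<open>deriv F * exp (- h) = deriv g + g * deriv h\<close> is moderate by Cauchy's inequality. So
  \<open>exponent_le_of_bounded_product\<close> applies to \<open>Q * exp (- h)\<close>.
\<close>
lemma exponent_unit_disc_le:
  assumes hol: "g holomorphic_on UNIV" "h holomorphic_on UNIV" "w holomorphic_on UNIV"
    and f: "\<And>z. f z = g z * exp (h z)" and h0: "h 0 = 0"
    and share: "\<And>z. f z = a \<Longrightarrow> w z = 0"
    and \<eta>: "0 < \<eta>" "\<eta> \<le> 1" and X: "X \<ge> 1" and Y: "Y \<ge> 1"
    and g_le: "\<And>z. norm z \<le> 1 + \<eta> \<Longrightarrow> norm (g z) \<le> exp X"
    and w_le: "\<And>z. norm z \<le> 1 + \<eta> \<Longrightarrow> norm (w z) \<le> exp X"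
    and h_le: "\<And>z. norm z \<le> 1 + \<eta> \<Longrightarrow> norm (h z) \<le> Y"
    and a: "exp (-X) \<le> norm a" "norm a \<le> exp X"
    and lo: "exp (-X) \<le> norm (w 0)" "exp (-X) \<le> norm (deriv f 0)" "exp (-X) \<le> norm (f 0 - a)"
    and z: "norm z \<le> 1"
  shows "norm (h z) \<le> 2200 / \<eta> * (X + ln Y + ln (1 / \<eta>))"
proof -
  define F where "F = (\<lambda>z. f z - a)"
  define M where "M = X + Y + 1"
  define B where "B = 6000 * exp (3 * X) * (M\<^sup>2 / \<eta> ^ 3)"
  have exp2: "exp (2 * X) = exp X * exp X" and exp3: "exp (3 * X) = exp X * exp X * exp X"
    by (simp_all flip: exp_add)
  have f_hol: "f holomorphic_on UNIV"
    unfolding f[abs_def] by (intro holomorphic_intros hol)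
  have F_hol: "F holomorphic_on UNIV"
    unfolding F_def by (intro holomorphic_intros f_hol)
  have dF: "deriv F z = deriv f z" for z
    unfolding F_def using f_hol
    by (subst deriv_diff) (auto simp: holomorphic_on_imp_differentiable_at)
  have F_le: "norm (F z) \<le> exp M" if "norm z = 1 + \<eta>" for z
  proof -
    have "norm (F z) \<le> norm (g z) * exp (Re (h z)) + norm a"
      using norm_triangle_ineq4[of "f z" a] by (simp add: F_def f norm_mult)
    also have "\<dots> \<le> exp X * exp Y + exp X * exp Y"
    proof (intro add_mono mult_mono)
      show "exp (Re (h z)) \<le> exp Y"
        using complex_Re_le_cmod[of "h z"] h_le[of z] that by simp
      show "norm a \<le> exp X * exp Y"
      proof -
        have "norm a \<le> exp X * 1"
          using a(2) by simp
        also have "\<dots> \<le> exp X * exp Y"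
          using Y by (intro mult_left_mono) auto
        finally show ?thesis .
      qed
    qed (use g_le that in auto)
    also have "\<dots> = 2 * (exp X * exp Y)"
      by simp
    also have "\<dots> \<le> exp 1 * (exp X * exp Y)"
      using exp_ge_add_one_self[of 1] by (intro mult_right_mono) auto
    also have "\<dots> = exp M"
      by (simp add: M_def exp_add)
    finally show ?thesis .
  qed
  have M: "1 \<le> M"
    using X Y by (simp add: M_def)
  have F_lo: "exp (-M) \<le> norm (F 0)"
  proof -
    have "exp (-M) \<le> exp (-X)"
      using Y by (simp add: M_def)
    from this lo(3) show ?thesis
      unfolding F_def by (rule order.trans)
  qed
  obtain r ps E where r: "1 + \<eta>/4 \<le> r" "r \<le> 1 + \<eta>/2" and E: "E holomorphic_on UNIV"
    and eq: "\<And>z. F z = (\<Prod>p\<leftarrow>ps. z - p) * E z" and nz: "\<And>z. norm z \<le> 1 + 3*\<eta>/4 \<Longrightarrow> E z \<noteq> 0"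
    and D: "\<And>z. norm z = r \<Longrightarrow> F z \<noteq> 0 \<and> norm (deriv F z / F z) \<le> 3000 * M\<^sup>2 / \<eta>^3"
    by (rule logderiv_on_circle_le[OF F_hol \<eta> M F_le F_lo], assumption) (rule that; assumption)
  define S where "S = ball (0::complex) (1 + 3*\<eta>/4)"
  have wz: "w z = 0" if "F z = 0" for z
    using share[of z] that by (simp add: F_def)
  have "\<exists>Q. Q holomorphic_on S \<and> (\<forall>z\<in>S. F z \<noteq> 0 \<longrightarrow> Q z = w z * (deriv F z / F z))"
  proof (rule logderiv_times_holomorphic_extension[OF E eq _ _ hol(3) wz, of S])
    show "E z \<noteq> 0" if "z \<in> S" for z
      using that by (intro nz) (auto simp: S_def)
  qed (auto simp: S_def)
  then obtain Q where Q: "Q holomorphic_on S" "\<And>z. z \<in> S \<Longrightarrow> F z \<noteq> 0 \<Longrightarrow> Q z = w z * (deriv F z / F z)"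
    by blast
  have circ: "z \<in> S" "norm z \<le> 1 + \<eta>" if "norm z = r" for z
    using that r \<eta> by (auto simp: S_def)
  have Bpos: "M\<^sup>2 / \<eta> ^ 3 \<ge> 1"
  proof -
    have "\<eta> ^ 3 \<le> 1" "1 \<le> M\<^sup>2"
      using \<eta> M by (auto intro: power_le_one)
    then show ?thesis
      using \<eta> by (simp add: field_simps)
  qed
  have Q_le: "norm (Q z) \<le> 3000 * exp X * (M\<^sup>2 / \<eta> ^ 3)" if "norm z = r" for z
  proof -
    have "norm (Q z) = norm (w z) * norm (deriv F z / F z)"
      using Q(2)[of z] circ[OF that] D[OF that] by (simp add: norm_mult norm_divide)
    also have "\<dots> \<le> exp X * (3000 * M\<^sup>2 / \<eta> ^ 3)"
      using w_le circ[OF that] D[OF that] by (intro mult_mono) auto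
    finally show ?thesis
      by (simp add: mult_ac)
  qed
  have Q_exp_le: "norm (Q z * exp (- h z)) \<le> B" if z: "norm z = r" for z
  proof (cases "norm (f z) \<le> norm a / 2")
    case True
    have "norm a \<le> norm (F z) + norm (f z)"
      using norm_triangle_ineq4[of "f z" "F z"] by (simp add: F_def)
    with True have F_ge: "norm a / 2 \<le> norm (F z)"
      by simp
    have "(h has_field_derivative deriv h z) (at z)" "(g has_field_derivative deriv g z) (at z)"
      using hol by (auto intro: holomorphic_derivI)
    then have "(f has_field_derivative (deriv g z + g z * deriv h z) * exp (h z)) (at z)"
      unfolding f[abs_def] by (auto intro!: derivative_eq_intros simp: algebra_simps)
    then have df: "deriv F z = (deriv g z + g z * deriv h z) * exp (h z)"
      unfolding dF by (rule DERIV_imp_deriv)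
    have d: "norm (deriv g z) \<le> exp X / (\<eta>/2)" "norm (deriv h z) \<le> Y / (\<eta>/2)"
      using z r \<eta> g_le h_le norm_deriv_le_of_bound[OF hol(1), of "\<eta>/2" z "1 + \<eta>" "exp X"]
        norm_deriv_le_of_bound[OF hol(2), of "\<eta>/2" z "1 + \<eta>" Y] by auto
    have "norm (deriv g z + g z * deriv h z) \<le> exp X / (\<eta>/2) + exp X * (Y / (\<eta>/2))"
    proof (rule order.trans[OF norm_triangle_ineq add_mono[OF d(1)]])
      show "norm (g z * deriv h z) \<le> exp X * (Y / (\<eta>/2))"
        unfolding norm_mult using d(2) g_le[OF circ(2)[OF z]] by (intro mult_mono) auto
    qed
    also have "\<dots> \<le> exp X * (4 * Y / \<eta>)"
      using Y \<eta> by (simp add: field_simps)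
    finally have \<psi>: "norm (deriv g z + g z * deriv h z) \<le> exp X * (4 * Y / \<eta>)" .
    have "Q z * exp (- h z) = w z * (deriv g z + g z * deriv h z) / F z"
      using Q(2)[of z] circ[OF z] D[OF z] by (simp add: df exp_minus field_simps)
    also have "norm \<dots> \<le> exp X * (exp X * (4 * Y / \<eta>)) / (exp (-X) / 2)"
      unfolding norm_divide norm_mult using \<psi> w_le[OF circ(2)[OF z]] F_ge a Y \<eta>
      by (intro frac_le mult_mono) auto
    also have "\<dots> = 8 * exp (3 * X) * (Y / \<eta>)"
      unfolding exp3 exp_minus by (simp add: field_simps)
    also have "\<dots> \<le> 6000 * exp (3 * X) * (M\<^sup>2 / \<eta> ^ 3)"
    proof (intro mult_mono frac_le)
      show "Y \<le> M\<^sup>2"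
        using M X Y mult_mono[of 1 M Y M] by (simp add: power2_eq_square M_def)
      show "\<eta> ^ 3 \<le> \<eta>"
        using \<eta> power_decreasing[of 1 3 \<eta>] by simp
    qed (use Y \<eta> in auto)
    finally show ?thesis
      by (simp add: B_def)
  next
    case False
    have "f z \<noteq> 0"
      using False by auto
    then have "exp (- h z) = g z / f z"
      by (simp add: f exp_minus field_simps)
    also have "norm \<dots> \<le> exp X / (exp (-X) / 2)"
      unfolding norm_divide using g_le[OF circ(2)[OF z]] False a by (intro frac_le) auto
    also have "\<dots> = 2 * exp (2 * X)"
      unfolding exp2 exp_minus by (simp add: field_simps)
    finally have "norm (Q z * exp (- h z)) \<le> (3000 * exp X * (M\<^sup>2 / \<eta> ^ 3)) * (2 * exp (2 * X))"
      unfolding norm_mult using Q_le[OF z] \<eta> by (intro mult_mono) auto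
    also have "\<dots> = B"
      unfolding B_def exp2 exp3 by (simp add: mult_ac)
    finally show ?thesis .
  qed
  have B_ge: "6000 * exp (3 * X) \<le> B"
    using mult_left_mono[OF Bpos, of "6000 * exp (3 * X)"] unfolding B_def by simp
  have "1 \<le> exp (3 * X)"
    using X by simp
  with B_ge have B1: "B \<ge> 6000"
    by linarith
  have Q0: "1 / B \<le> norm (Q 0 * exp (- h 0))"
  proof -
    have F0: "F 0 \<noteq> 0"
      using F_lo by auto
    have "norm (F 0) \<le> norm (g 0) + norm a"
      using norm_triangle_ineq4[of "f 0" a] h0 by (simp add: F_def f)
    also have "\<dots> \<le> 2 * exp X"
      using g_le[of 0] \<eta> a by simp
    finally have "norm (F 0) \<le> 2 * exp X" .
    have "1 / B \<le> 1 / (6000 * exp (3 * X))"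
      using B_ge by (intro frac_le) auto
    also have "\<dots> \<le> exp (-X) * exp (-X) / (2 * exp X)"
      unfolding exp3 exp_minus by (simp add: field_simps)
    also have "\<dots> \<le> norm (w 0) * norm (deriv F 0) / norm (F 0)"
      unfolding dF using lo F0 \<open>norm (F 0) \<le> 2 * exp X\<close> by (intro frac_le mult_mono) auto
    also have "\<dots> = norm (Q 0 * exp (- h 0))"
      using Q(2)[of 0] \<eta> F0 h0 by (simp add: S_def norm_mult norm_divide)
    finally show ?thesis .
  qed
  have "norm (h z) \<le> 12 * ln B * norm z / (1 + \<eta>/8 - norm z)"
  proof (rule exponent_le_of_bounded_product[where S = S and Q = "\<lambda>z. Q z * exp (- h z)" and R = r])
    have hS: "h holomorphic_on S"
      using hol by (auto intro: holomorphic_on_subset)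
    then show "(\<lambda>z. Q z * exp (- h z)) holomorphic_on S" "h holomorphic_on S"
      using Q(1) by (auto intro!: holomorphic_intros)
    show "norm (Q z * exp (- h z)) \<le> B" if "norm z = r" for z
      using Q_exp_le[OF that] .
    show "norm (Q z * exp (- h z) * exp (h z)) \<le> B" if "norm z = r" for z
    proof -
      have "norm (Q z * exp (- h z) * exp (h z)) = norm (Q z)"
        by (simp add: exp_minus mult.assoc)
      also have "\<dots> \<le> 3000 * exp X * (M\<^sup>2 / \<eta> ^ 3)"
        by (rule Q_le[OF that])
      also have "\<dots> \<le> B"
        unfolding B_def using X \<eta> by (intro mult_right_mono mult_mono) auto
      finally show ?thesis .
    qed
    show "cball 0 r \<subseteq> S"
      using r \<eta> by (auto simp: S_def)
  qed (use h0 r \<eta> B1 Q0 z in \<open>auto simp: S_def\<close>)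
  also have "\<dots> \<le> 12 * ln B * 1 / (\<eta>/8)"
    using z \<eta> B1 by (intro frac_le mult_mono) auto
  also have "\<dots> = 96 / \<eta> * ln B"
    by simp
  also have "\<dots> \<le> 96 / \<eta> * (22 * (X + ln Y + ln (1 / \<eta>)))"
  proof (intro mult_left_mono)
    (* B = 6000 * exp (3 * X) * (M^2 / \<eta>^3), and M is at most 3 * X * Y. *)
    have "ln (6000::real) \<le> 13"
    proof -
      have "(6000::real) \<le> 2 ^ 13"
        by simp
      also have "\<dots> \<le> exp 1 ^ 13"
        using exp_ge_add_one_self[of 1] by (intro power_mono) auto
      also have "\<dots> = exp 13"
        by (simp flip: exp_of_nat_mult)
      finally have "ln (6000::real) \<le> ln (exp 13)"
        by (subst ln_le_cancel_iff) auto
      then show ?thesis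
        by simp
    qed
    moreover have "ln M \<le> 2 + X + ln Y"
    proof -
      have "M \<le> 3 * (X * Y)"
      proof -
        have "X * 1 \<le> X * Y" "1 * Y \<le> X * Y"
          using X Y by (intro mult_mono; simp)+
        then show ?thesis
          using X unfolding M_def by linarith
      qed
      then have "ln M \<le> ln (3 * (X * Y))"
        using M by simp
      also have "\<dots> = ln 3 + ln X + ln Y"
        using X Y by (simp add: ln_mult)
      also have "\<dots> \<le> 2 + X + ln Y"
        using ln_le_minus_one[of 3] ln_le_minus_one[of X] X by simp
      finally show ?thesis .
    qed
    moreover have "ln B = ln 6000 + 3 * X + 2 * ln M + 3 * ln (1 / \<eta>)"
      using M \<eta> by (simp add: B_def ln_mult ln_div ln_realpow)
    moreover have "0 \<le> ln Y" "0 \<le> ln (1 / \<eta>)"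
      using Y \<eta> by auto
    ultimately show "ln B \<le> 22 * (X + ln Y + ln (1 / \<eta>))"
      using X unfolding distrib_left by linarith
  qed (use \<eta> in auto)
  also have "\<dots> \<le> 2200 / \<eta> * (X + ln Y + ln (1 / \<eta>))"
  proof -
    have "0 \<le> X + ln Y + ln (1 / \<eta>)"
      using X Y \<eta> by (intro add_nonneg_nonneg) auto
    then have "(96 * 22) * (X + ln Y + ln (1 / \<eta>)) / \<eta> \<le> 2200 * (X + ln Y + ln (1 / \<eta>)) / \<eta>"
      using \<eta> by (intro divide_right_mono mult_right_mono) auto
    then show ?thesis
      by (simp add: field_simps)
  qed
  finally show ?thesis .
qed

section \<open>Growth of entire functions\<close>

text \<open>
  Borel's growth lemma. If the inequality failed for all \<open>R\<close>, iterating \<open>R \<mapsto> R * (1 + 1 / (ln (A R))\<^sup>2)\<close> would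
  at least square \<open>A\<close> each time. Then \<open>ln (A R)\<close> is at least \<open>2 ^ n\<close> after \<open>n\<close> steps, so the radii
  grow by factors at most \<open>1 + 1 / 4 ^ n\<close>, whose product converges, and \<open>A\<close> would be unbounded on a bounded interval.
\<close>
lemma growth_regularity:
  fixes A :: "real \<Rightarrow> real"
  assumes mono: "\<And>x y. R0 \<le> x \<Longrightarrow> x \<le> y \<Longrightarrow> A x \<le> A y" and R0: "R0 > 0" and A0: "A R0 \<ge> exp 1"
  shows "\<exists>R\<ge>R0. A (R * (1 + 1 / (ln (A R))\<^sup>2)) \<le> (A R)\<^sup>2"
proof (rule ccontr)
  assume "\<not> ?thesis"
  then have fast: "(A R)\<^sup>2 < A (R * (1 + 1 / (ln (A R))\<^sup>2))" if "R \<ge> R0" for R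
    using that by force
  define r where "r = rec_nat R0 (\<lambda>_ R. R * (1 + 1 / (ln (A R))\<^sup>2))"
  have r0: "r 0 = R0" and r_Suc: "r (Suc n) = r n * (1 + 1 / (ln (A (r n)))\<^sup>2)" for n
    by (simp_all add: r_def)
  have inv: "R0 \<le> r n \<and> exp (2 ^ n) \<le> A (r n) \<and> r n \<le> R0 * exp (\<Sum>k<n. (1/4) ^ k)" for n
  proof (induction n)
    case 0
    then show ?case
      using A0 by (simp add: r0)
  next
    case (Suc n)
    define L where "L = ln (A (r n))"
    have "0 < A (r n)"
      using Suc by (meson exp_gt_zero less_le_trans)
    then have L: "2 ^ n \<le> L"
      using Suc by (simp add: L_def ln_ge_iff)
    have "(0::real) < 2 ^ n"
      by simp
    with L have "L > 0"
      by linarith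
    have "1 / L\<^sup>2 \<le> 1 / (2 ^ n)\<^sup>2"
      using L \<open>L > 0\<close> by (intro frac_le power_mono) auto
    also have "((2::real) ^ n)\<^sup>2 = 4 ^ n"
      by (simp add: power2_eq_square flip: power_mult_distrib)
    also have "1 / (4::real) ^ n = (1/4) ^ n"
      by (simp add: power_divide)
    finally have step: "1 + 1 / L\<^sup>2 \<le> exp ((1/4) ^ n)"
      using exp_ge_add_one_self[of "(1/4) ^ n"] by linarith
    have "r n * 1 \<le> r n * (1 + 1 / L\<^sup>2)"
      using Suc R0 by (intro mult_left_mono) auto
    then have 1: "R0 \<le> r (Suc n)"
      using Suc by (simp add: r_Suc L_def)
    have "exp (2 ^ Suc n) = (exp (2 ^ n))\<^sup>2"
      by (simp flip: exp_double)
    also have "\<dots> \<le> (A (r n))\<^sup>2"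
      using Suc by (intro power_mono) auto
    also have "\<dots> \<le> A (r (Suc n))"
      using fast[of "r n"] Suc by (simp add: r_Suc)
    finally have 2: "exp (2 ^ Suc n) \<le> A (r (Suc n))" .
    have "r (Suc n) \<le> (R0 * exp (\<Sum>k<n. (1/4) ^ k)) * exp ((1/4) ^ n)"
      unfolding r_Suc L_def[symmetric] using Suc R0 step by (intro mult_mono) auto
    also have "\<dots> = R0 * exp (\<Sum>k<Suc n. (1/4) ^ k)"
      by (simp add: exp_add)
    finally show ?case
      using 1 2 by blast
  qed
  have bound: "2 ^ n \<le> ln (A (R0 * exp 2))" for n :: nat
  proof -
    have "(\<Sum>k<n. (1/4::real) ^ k) \<le> (\<Sum>k. (1/4) ^ k)"
      by (intro sum_le_suminf summable_geometric) auto
    also have "\<dots> \<le> 2"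
      by (subst suminf_geometric) auto
    finally have "r n \<le> R0 * exp 2"
      using inv[of n] R0 by (smt (verit) exp_le_cancel_iff mult_le_cancel_left_pos)
    then have "exp (2 ^ n) \<le> A (R0 * exp 2)"
      using inv[of n] mono[of "r n" "R0 * exp 2"] by linarith
    then show ?thesis
      by (metis exp_gt_zero less_le_trans ln_ge_iff)
  qed
  obtain n where "ln (A (R0 * exp 2)) < 2 ^ n"
    using real_arch_pow[of 2] by auto
  with bound[of n] show False
    by simp
qed

lemma max_norm_exists:
  fixes h :: "complex \<Rightarrow> complex"
  assumes "continuous_on UNIV h" "R \<ge> 0"
  obtains z where "norm z \<le> R" "\<And>u. norm u \<le> R \<Longrightarrow> norm (h u) \<le> norm (h z)"
proof -
  have "compact (cball (0::complex) R)" "cball (0::complex) R \<noteq> {}" "continuous_on (cball 0 R) (\<lambda>z. norm (h z))"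
    using assms by (auto intro!: continuous_intros intro: continuous_on_subset)
  from continuous_attains_sup[OF this] show thesis
    using that by auto
qed

text \<open>
  If \<open>h\<close> is not affine, its maximum modulus \<open>A R\<close> is at least \<open>c * R\<^sup>2\<close>. At a radius provided by
  \<open>growth_regularity\<close>, with \<open>L = ln (A R)\<close> and \<open>\<eta> = 1 / L\<^sup>2\<close>, the hypothesis with \<open>Y = (A R)\<^sup>2\<close> gives
  \<open>exp L \<le> C * L\<^sup>2 * (R + 2 * L + 2 * ln L)\<close>, where \<open>R\<close> is at most a multiple of \<open>exp (L/2)\<close>. That is absurd
  for large \<open>L\<close>.
\<close>
lemma affine_if_subquadratic_growth:
  fixes h :: "complex \<Rightarrow> complex"
  assumes h: "h holomorphic_on UNIV" and C: "C > 0"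
    and est: "\<And>R \<eta> Y z. 1 \<le> R \<Longrightarrow> 0 < \<eta> \<Longrightarrow> \<eta> \<le> 1 \<Longrightarrow> 1 \<le> Y \<Longrightarrow>
       (\<And>u. norm u \<le> R * (1 + \<eta>) \<Longrightarrow> norm (h u) \<le> Y) \<Longrightarrow> norm z \<le> R \<Longrightarrow>
       norm (h z) \<le> C / \<eta> * (R + ln Y + ln (1 / \<eta>))"
  shows "h z = h 0 + deriv h 0 * z"
proof -
  have coeff: "(deriv ^^ k) h 0 = 0" if k: "k \<ge> 2" for k
  proof (rule ccontr)
    assume nz: "(deriv ^^ k) h 0 \<noteq> 0"
    define c where "c = norm ((deriv ^^ k) h 0) / fact k"
    have c: "c > 0"
      using nz by (simp add: c_def)
    define A where "A = (\<lambda>R. Sup ((\<lambda>z. norm (h z)) ` cball 0 R))"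
    have cont: "continuous_on UNIV h"
      using h holomorphic_on_imp_continuous_on by blast
    have A: "\<exists>z. norm z \<le> R \<and> norm (h z) = A R" "norm u \<le> R \<Longrightarrow> norm (h u) \<le> A R" if R: "R \<ge> 0" for R u
    proof -
      obtain z where z: "norm z \<le> R" "\<And>u. norm u \<le> R \<Longrightarrow> norm (h u) \<le> norm (h z)"
        using max_norm_exists[OF cont R] by blast
      have "A R = norm (h z)"
        unfolding A_def by (rule cSup_eq_maximum) (use z in auto)
      with z show "\<exists>z. norm z \<le> R \<and> norm (h z) = A R" "norm u \<le> R \<Longrightarrow> norm (h u) \<le> A R"
        by auto
    qed
    have A_mono: "A x \<le> A y" if "0 \<le> x" "x \<le> y" for x y
      using A(1)[of x] A(2)[of y] that by (metis order.trans)
    have A_ge: "c * R\<^sup>2 \<le> A R" if R: "R \<ge> 1" for R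
    proof -
      have "norm ((deriv ^^ k) h 0) \<le> fact k * A R / R ^ k"
      proof (rule Cauchy_inequality)
        show "norm (h x) \<le> A R" if "norm (0 - x) = R" for x
          using A(2)[of R x] R that by simp
        show "h holomorphic_on ball 0 R" "continuous_on (cball 0 R) h"
          using h cont by (auto intro: holomorphic_on_subset continuous_on_subset)
      qed (use R in auto)
      then have "c * R ^ k \<le> A R"
        using R by (simp add: c_def field_simps)
      moreover have "c * R\<^sup>2 \<le> c * R ^ k"
        using R c k by (intro mult_left_mono power_increasing) auto
      ultimately show ?thesis
        by linarith
    qed
    have "eventually (\<lambda>L::real. C * L\<^sup>2 * (exp (L/2) / sqrt c + 2 * L + 2 * ln L) < exp L) at_top"
      using C c by real_asymp
    then obtain L0 where L0: "\<And>L. L \<ge> L0 \<Longrightarrow> C * L\<^sup>2 * (exp (L/2) / sqrt c + 2 * L + 2 * ln L) < exp L"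
      by (auto simp: eventually_at_top_linorder)
    define L1 where "L1 = max L0 1"
    define R0 where "R0 = max 1 (exp L1 / c)"
    have R0: "R0 \<ge> 1"
      by (simp add: R0_def)
    have A0: "exp L1 \<le> A R0"
    proof -
      have "exp L1 \<le> c * R0"
        using c by (simp add: R0_def field_simps max_def)
      also have "\<dots> \<le> c * R0\<^sup>2"
        using R0 c by (simp add: power2_eq_square)
      finally show ?thesis
        using A_ge[OF R0] by simp
    qed
    have "\<exists>R\<ge>R0. A (R * (1 + 1 / (ln (A R))\<^sup>2)) \<le> (A R)\<^sup>2"
    proof (rule growth_regularity)
      have "exp 1 \<le> exp L1"
        by (simp add: L1_def)
      with A0 show "exp 1 \<le> A R0"
        by linarith
    qed (use A_mono R0 in auto)
    then obtain R where R: "R \<ge> R0" "A (R * (1 + 1 / (ln (A R))\<^sup>2)) \<le> (A R)\<^sup>2"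
      by blast
    define L where "L = ln (A R)"
    have AR: "exp L1 \<le> A R"
      using A0 A_mono[of R0 R] R R0 by linarith
    then have "A R > 0"
      by (meson exp_gt_zero less_le_trans)
    then have expL: "exp L = A R"
      by (simp add: L_def)
    have L: "L \<ge> L1"
      using AR unfolding expL[symmetric] by simp
    then have L_ge: "L \<ge> 1" "L \<ge> L0"
      by (auto simp: L1_def)
    define \<eta> where "\<eta> = 1 / L\<^sup>2"
    have \<eta>: "0 < \<eta>" "\<eta> \<le> 1"
      using L_ge by (auto simp: \<eta>_def)
    obtain z where z: "norm z \<le> R" "norm (h z) = A R"
      using A(1)[of R] R R0 by auto
    have "norm (h z) \<le> C / \<eta> * (R + ln ((A R)\<^sup>2) + ln (1 / \<eta>))"
    proof (rule est)
      show "1 \<le> (A R)\<^sup>2"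
        using L_ge unfolding expL[symmetric] by simp
      show "norm (h u) \<le> (A R)\<^sup>2" if "norm u \<le> R * (1 + \<eta>)" for u
        using A(2)[of "R * (1 + \<eta>)" u] that R R0 \<eta> unfolding \<eta>_def L_def by auto
    qed (use \<eta> R R0 z in auto)
    then have "exp L \<le> C * L\<^sup>2 * (R + 2 * L + 2 * ln L)"
      using L_ge \<open>A R > 0\<close> by (simp add: z expL \<eta>_def ln_realpow L_def)
    also have "\<dots> \<le> C * L\<^sup>2 * (exp (L/2) / sqrt c + 2 * L + 2 * ln L)"
    proof -
      have "(R * sqrt c)\<^sup>2 \<le> (exp (L/2))\<^sup>2"
        using A_ge[of R] R R0 c by (simp add: power_mult_distrib expL mult.commute flip: exp_double)
      then have "R * sqrt c \<le> exp (L/2)"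
        by (rule power2_le_imp_le) auto
      then have "R \<le> exp (L/2) / sqrt c"
        using c by (simp add: field_simps)
      then show ?thesis
        using C by (intro mult_left_mono) auto
    qed
    also have "\<dots> < exp L"
      using L0 L_ge by blast
    finally show False
      by simp
  qed
  have "(\<lambda>n. (deriv ^^ n) h 0 / fact n * (z - 0) ^ n) sums h z"
    by (rule holomorphic_power_series[of h 0 "norm z + 1"]) (use h in \<open>auto intro: holomorphic_on_subset\<close>)
  moreover have "(\<lambda>n. (deriv ^^ n) h 0 / fact n * (z - 0) ^ n) sums (\<Sum>n<2. (deriv ^^ n) h 0 / fact n * (z - 0) ^ n)"
    using coeff by (intro sums_finite) auto
  ultimately have "h z = (\<Sum>n<2. (deriv ^^ n) h 0 / fact n * (z - 0) ^ n)"
    by (rule sums_unique2)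
  then show ?thesis
    by (simp add: numeral_2_eq_2)
qed

text \<open>
  The estimate on the unit disc is applied to \<open>f\<close>, \<open>g\<close>, \<open>w\<close> and \<open>h\<close> after the substitution of
  \<open>z0 + R * u\<close> for the variable. The centre \<open>z0\<close> is chosen such that \<open>w\<close>, \<open>deriv f\<close> and
  \<open>f - a\<close> do not vanish there, and the factor \<open>exp (h z0)\<close> is moved from \<open>exp h\<close> to \<open>g\<close> so that the exponent
  vanishes at the centre. All constants are absorbed into \<open>\<kappa>\<close>, so that the parameter \<open>X\<close> is linear in \<open>R\<close>.
\<close>
lemma exponent_affine_nonconstant:
  assumes hol: "g holomorphic_on UNIV" "h holomorphic_on UNIV" "w holomorphic_on UNIV"
    and K: "K \<ge> 0"
    and g_le: "\<And>z. norm (g z) \<le> exp (K * (1 + norm z))"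
    and w_le: "\<And>z. norm (w z) \<le> exp (K * (1 + norm z))"
    and f: "\<And>z. f z = g z * exp (h z)" and a: "a \<noteq> 0"
    and share: "\<And>z. f z = a \<Longrightarrow> w z = 0"
    and w_nz: "w z1 \<noteq> 0" and f_nc: "deriv f z2 \<noteq> 0"
  shows "h z = h 0 + deriv h 0 * z"
proof -
  have f_hol: "f holomorphic_on UNIV"
    unfolding f[abs_def] by (intro holomorphic_intros hol)
  have "\<forall>\<^sub>F z in at z2. w z \<noteq> 0 \<and> z \<in> UNIV"
    using w_nz hol(3) by (intro non_zero_neighbour_alt[where \<beta> = z1]) auto
  moreover have "\<forall>\<^sub>F z in at z2. deriv f z \<noteq> 0 \<and> z \<in> UNIV"
    using f_nc holomorphic_deriv[OF f_hol] by (intro non_zero_neighbour_alt[where \<beta> = z2]) auto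
  ultimately have "\<forall>\<^sub>F z in at z2. w z \<noteq> 0 \<and> deriv f z \<noteq> 0"
    by eventually_elim auto
  then obtain z0 where z0: "w z0 \<noteq> 0" "deriv f z0 \<noteq> 0"
    using eventually_happens[of _ "at z2"] by (auto simp: trivial_limit_at)
  then have fa: "f z0 - a \<noteq> 0"
    using share by auto
  define \<kappa> where "\<kappa> = 1 + K * (3 + norm z0) + norm (h z0) + \<bar>ln (norm a)\<bar> + \<bar>ln (norm (w z0))\<bar>
      + \<bar>ln (norm (deriv f z0))\<bar> + \<bar>ln (norm (f z0 - a))\<bar>"
  have \<kappa>1: "\<kappa> \<ge> 1"
    using K by (simp add: \<kappa>_def)
  define H where "H = (\<lambda>z. h (z0 + z) - h z0)"
  have H_hol: "H holomorphic_on UNIV"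
    unfolding H_def by (intro holomorphic_intros holomorphic_on_compose_gen[OF _ hol(2), unfolded o_def]) auto
  have "H z = H 0 + deriv H 0 * z" for z
  proof (rule affine_if_subquadratic_growth[OF H_hol, of "2200 * \<kappa>"])
    fix R \<eta> Y :: real and z :: complex
    assume R: "1 \<le> R" and \<eta>: "0 < \<eta>" "\<eta> \<le> 1" and Y: "1 \<le> Y"
      and H_le: "\<And>u. norm u \<le> R * (1 + \<eta>) \<Longrightarrow> norm (H u) \<le> Y" and z: "norm z \<le> R"
    define X where "X = \<kappa> * R"
    have X: "\<kappa> \<le> X"
      using R \<kappa>1 by (simp add: X_def)
    define m where "m = (\<lambda>u. z0 + of_real R * u)"
    have m_hol: "(\<lambda>u. F (m u)) holomorphic_on UNIV" if "F holomorphic_on UNIV" for F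
      unfolding m_def by (intro holomorphic_on_compose_gen[OF _ that, unfolded o_def] holomorphic_intros) auto
    have expo: "K * (1 + norm (m u)) + norm (h z0) \<le> X" if "norm u \<le> 1 + \<eta>" for u
    proof -
      have "norm (m u) \<le> norm z0 + R * norm u"
        unfolding m_def using norm_triangle_ineq[of z0 "of_real R * u"] R by (simp add: norm_mult)
      also have "\<dots> \<le> norm z0 + R * 2"
        using that \<eta> R by (intro add_left_mono mult_left_mono) auto
      finally have "1 + norm (m u) \<le> (3 + norm z0) * R"
      proof -
        assume "norm (m u) \<le> norm z0 + R * 2"
        moreover have "norm z0 * 1 \<le> norm z0 * R"
          using R by (intro mult_left_mono) auto
        ultimately show ?thesis
          using R by (simp add: algebra_simps)
      qed
      then have "K * (1 + norm (m u)) \<le> K * ((3 + norm z0) * R)"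
        using K by (intro mult_left_mono) auto
      moreover have "norm (h z0) * 1 \<le> norm (h z0) * R"
        using R by (intro mult_left_mono) auto
      ultimately have "K * (1 + norm (m u)) + norm (h z0) \<le> (K * (3 + norm z0) + norm (h z0)) * R"
        by (simp add: algebra_simps)
      also have "\<dots> \<le> X"
        unfolding X_def \<kappa>_def using R by (intro mult_right_mono) auto
      finally show ?thesis .
    qed
    have lower: "exp (-X) \<le> t \<and> t \<le> exp X" if "t > 0" "\<bar>ln t\<bar> \<le> \<kappa>" for t :: real
    proof -
      have "- X \<le> ln t" "ln t \<le> X"
        using that X by linarith+
      then have "exp (-X) \<le> exp (ln t)" "exp (ln t) \<le> exp X"
        by (simp_all only: exp_le_cancel_iff)
      with that show ?thesis
        by simp
    qed
    have df: "deriv (\<lambda>u. f (m u)) 0 = deriv f z0 * of_real R"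
    proof -
      have "(f has_field_derivative deriv f z0) (at (m 0))"
        using f_hol by (auto simp: m_def intro: holomorphic_derivI)
      moreover have "(m has_field_derivative of_real R) (at 0)"
        unfolding m_def by (auto intro!: derivative_eq_intros)
      ultimately have "((\<lambda>u. f (m u)) has_field_derivative deriv f z0 * of_real R) (at 0)"
        using DERIV_chain2 by fastforce
      then show ?thesis
        by (rule DERIV_imp_deriv)
    qed
    have "norm (H (of_real R * (z / of_real R))) \<le> 2200 / \<eta> * (X + ln Y + ln (1 / \<eta>))"
    proof (rule exponent_unit_disc_le[where f = "\<lambda>u. f (m u)" and w = "\<lambda>u. w (m u)" and a = a
          and g = "\<lambda>u. g (m u) * exp (h z0)" and h = "\<lambda>u. H (of_real R * u)"])
      show "(\<lambda>u. g (m u) * exp (h z0)) holomorphic_on UNIV" "(\<lambda>u. w (m u)) holomorphic_on UNIV"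
        using m_hol hol by (auto intro!: holomorphic_intros)
      show "(\<lambda>u. H (of_real R * u)) holomorphic_on UNIV"
        by (intro holomorphic_on_compose_gen[OF _ H_hol, unfolded o_def] holomorphic_intros) auto
      show "f (m u) = g (m u) * exp (h z0) * exp (H (of_real R * u))" for u
        by (simp add: f H_def m_def exp_diff)
      show "norm (g (m u) * exp (h z0)) \<le> exp X" if "norm u \<le> 1 + \<eta>" for u
      proof -
        have "norm (g (m u) * exp (h z0)) \<le> exp (K * (1 + norm (m u))) * exp (norm (h z0))"
          unfolding norm_mult using g_le complex_Re_le_cmod[of "h z0"] by (intro mult_mono) auto
        also have "\<dots> = exp (K * (1 + norm (m u)) + norm (h z0))"
          by (simp add: exp_add)
        also have "\<dots> \<le> exp X"
          using expo[OF that] by simp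
        finally show ?thesis .
      qed
      show "norm (w (m u)) \<le> exp X" if "norm u \<le> 1 + \<eta>" for u
      proof -
        have "norm (w (m u)) \<le> exp (K * (1 + norm (m u)))"
          by (rule w_le)
        also have "\<dots> \<le> exp X"
          using expo[OF that] norm_ge_zero[of "h z0"] unfolding exp_le_cancel_iff by linarith
        finally show ?thesis .
      qed
      show "norm (H (of_real R * u)) \<le> Y" if "norm u \<le> 1 + \<eta>" for u
        using that R by (intro H_le) (auto simp: norm_mult)
      show "exp (-X) \<le> norm a" "norm a \<le> exp X"
        using lower[of "norm a"] a K by (auto simp: \<kappa>_def)
      show "exp (-X) \<le> norm (w (m 0))"
        using lower[of "norm (w z0)"] z0 K by (auto simp: \<kappa>_def m_def)
      show "exp (-X) \<le> norm (f (m 0) - a)"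
        using lower[of "norm (f z0 - a)"] fa K by (auto simp: \<kappa>_def m_def)
      show "exp (-X) \<le> norm (deriv (\<lambda>u. f (m u)) 0)"
      proof -
        have "exp (-X) \<le> norm (deriv f z0) * 1"
          using lower[of "norm (deriv f z0)"] z0 K by (auto simp: \<kappa>_def)
        also have "\<dots> \<le> norm (deriv f z0) * R"
          using R by (intro mult_left_mono) auto
        finally show ?thesis
          using R by (simp add: df norm_mult)
      qed
      show "norm (z / of_real R) \<le> 1"
        using z R by (simp add: norm_divide)
    qed (use share \<eta> Y X \<kappa>1 in \<open>auto simp: H_def\<close>)
    also have "\<dots> \<le> 2200 / \<eta> * (\<kappa> * (R + ln Y + ln (1 / \<eta>)))"
    proof (intro mult_left_mono)
      have "0 \<le> ln Y + ln (1 / \<eta>)"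
        using Y \<eta> by (intro add_nonneg_nonneg) auto
      then have "1 * (ln Y + ln (1 / \<eta>)) \<le> \<kappa> * (ln Y + ln (1 / \<eta>))"
        using \<kappa>1 by (intro mult_right_mono) auto
      then show "X + ln Y + ln (1 / \<eta>) \<le> \<kappa> * (R + ln Y + ln (1 / \<eta>))"
        unfolding X_def by (simp add: algebra_simps)
    qed (use \<eta> in auto)
    finally show "norm (H z) \<le> 2200 * \<kappa> / \<eta> * (R + ln Y + ln (1 / \<eta>))"
      using R by simp
  qed (use \<kappa>1 in auto)
  from this[of "z - z0" for z] have aff: "h z = h z0 + deriv H 0 * (z - z0)" for z
    by (simp add: H_def algebra_simps)
  have "((\<lambda>z. h z0 + deriv H 0 * (z - z0)) has_field_derivative deriv H 0) (at 0)"
    by (auto intro!: derivative_eq_intros)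
  moreover have "(\<lambda>z. h z0 + deriv H 0 * (z - z0)) = h"
    using aff by (intro ext) (rule sym)
  ultimately have "(h has_field_derivative deriv H 0) (at 0)"
    by simp
  then have "deriv h 0 = deriv H 0"
    by (rule DERIV_imp_deriv)
  moreover have "h z = h 0 + deriv H 0 * z"
  proof -
    have "h z = h z0 + deriv H 0 * (z - z0)"
      by (rule aff)
    also have "\<dots> = (h z0 + deriv H 0 * (0 - z0)) + deriv H 0 * z"
      by (simp add: algebra_simps)
    also have "h z0 + deriv H 0 * (0 - z0) = h 0"
      by (rule aff[symmetric])
    finally show ?thesis .
  qed
  ultimately show ?thesis
    by simp
qed

text \<open>
  For constant \<open>f = g * exp h\<close> with value \<open>c\<close>, the lemma \<open>exponent_affine_nonconstant\<close> is applied to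
  \<open>c * exp z = (g z * exp z) * exp (h z)\<close> instead, which takes the value \<open>c\<close> exactly at the zeros of \<open>exp z - 1\<close>.
\<close>
theorem exponent_affine:
  assumes hol: "g holomorphic_on UNIV" "h holomorphic_on UNIV" "w holomorphic_on UNIV"
    and K: "K \<ge> 0"
    and g_le: "\<And>z. norm (g z) \<le> exp (K * (1 + norm z))"
    and w_le: "\<And>z. norm (w z) \<le> exp (K * (1 + norm z))"
    and a: "a \<noteq> 0" and share: "\<And>z. g z * exp (h z) = a \<Longrightarrow> w z = 0"
    and w_nz: "w z1 \<noteq> 0" and g_nz: "g z2 \<noteq> 0"
  shows "h z = h 0 + deriv h 0 * z"
proof (cases "\<forall>z. deriv (\<lambda>z. g z * exp (h z)) z = 0")
  case False
  then show ?thesis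
    using exponent_affine_nonconstant[OF hol K g_le w_le refl a share w_nz] by blast
next
  case True
  define f where "f = (\<lambda>z. g z * exp (h z))"
  have "f holomorphic_on UNIV"
    unfolding f_def by (intro holomorphic_intros hol)
  then have "(f has_field_derivative 0) (at z)" for z
    using True holomorphic_derivI[of f UNIV z] unfolding f_def by simp
  then obtain c where c: "f z = c" for z
    using has_field_derivative_zero_constant[of UNIV f] by auto
  have "c \<noteq> 0"
    using g_nz c[of z2] by (auto simp: f_def)
  have exp_le: "norm (exp z) \<le> exp (norm z)" for z :: complex
    using complex_Re_le_cmod[of z] by simp
  show ?thesis
  proof (rule exponent_affine_nonconstant[where g = "\<lambda>z. g z * exp z" and h = h and K = "K + 1"
        and w = "\<lambda>z. exp z - 1" and f = "\<lambda>z. c * exp z" and a = c])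
    show "(\<lambda>z. g z * exp z) holomorphic_on UNIV" "h holomorphic_on UNIV" "(\<lambda>z. exp z - 1) holomorphic_on UNIV"
      using hol by (auto intro!: holomorphic_intros)
    show "norm (g z * exp z) \<le> exp ((K + 1) * (1 + norm z))" for z
    proof -
      have "norm (g z * exp z) \<le> exp (K * (1 + norm z)) * exp (norm z)"
        unfolding norm_mult by (intro mult_mono g_le exp_le) auto
      also have "\<dots> \<le> exp ((K + 1) * (1 + norm z))"
        by (simp add: algebra_simps flip: exp_add)
      finally show ?thesis .
    qed
    show "norm (exp z - 1) \<le> exp ((K + 1) * (1 + norm z))" for z :: complex
    proof -
      have "norm (exp z - 1) \<le> exp (norm z) + 1"
        using norm_triangle_ineq4[of "exp z" 1] exp_le[of z] unfolding norm_one by linarith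
      also have "\<dots> \<le> 2 * exp (norm z)"
        by simp
      also have "\<dots> \<le> exp 1 * exp (norm z)"
        using exp_ge_add_one_self[of 1] by (intro mult_right_mono) auto
      also have "\<dots> = exp (1 * (1 + norm z))"
        by (simp add: exp_add)
      also have "\<dots> \<le> exp ((K + 1) * (1 + norm z))"
        unfolding exp_le_cancel_iff using K by (intro mult_right_mono) auto
      finally show ?thesis .
    qed
    show "c * exp z = g z * exp z * exp (h z)" for z
      using c[of z] by (simp add: f_def)
    have "deriv (\<lambda>z. c * exp z) 0 = c"
      by (rule DERIV_imp_deriv) (auto intro!: derivative_eq_intros)
    then show "deriv (\<lambda>z. c * exp z) 0 \<noteq> 0"
      using \<open>c \<noteq> 0\<close> by simp
    show "exp (1::complex) - 1 \<noteq> 0"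
      using exp_eq_1[of 1] by simp
  qed (use K \<open>c \<noteq> 0\<close> in auto)
qed

section \<open>Kummer functions and shared values\<close>

text \<open>
  The quotients \<open>(\<alpha> + n) / (\<gamma> + n)\<close> converge to 1, hence are bounded.
\<close>
lemma pochhammer_ratio_bounded:
  fixes \<alpha> \<gamma> :: complex
  assumes "\<gamma> \<notin> \<int>\<^sub>\<le>\<^sub>0"
  obtains K where "K > 0" "\<And>n. norm (pochhammer \<alpha> n) \<le> K ^ n * norm (pochhammer \<gamma> n)"
proof -
  have nz: "\<gamma> + of_nat n \<noteq> 0" for n
    using assms by (metis add_eq_0_iff2 minus_of_nat_in_nonpos_Ints)
  have "(\<lambda>n. 1 + (\<alpha> - \<gamma>) / (\<gamma> + of_nat n)) \<longlonglongrightarrow> 1 + 0"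
    by (intro tendsto_add tendsto_const tendsto_divide_0[OF tendsto_const]
        tendsto_add_filterlim_at_infinity[OF tendsto_const] tendsto_of_nat)
  then have "Bseq (\<lambda>n. 1 + (\<alpha> - \<gamma>) / (\<gamma> + of_nat n))"
    by (intro convergent_imp_Bseq convergentI)
  then obtain K where K: "K > 0" "\<And>n. norm (1 + (\<alpha> - \<gamma>) / (\<gamma> + of_nat n)) \<le> K"
    by (auto simp: Bseq_def)
  have ratio: "norm (\<alpha> + of_nat n) \<le> K * norm (\<gamma> + of_nat n)" for n
  proof -
    have "\<alpha> + of_nat n = (1 + (\<alpha> - \<gamma>) / (\<gamma> + of_nat n)) * (\<gamma> + of_nat n)"
      using nz[of n] by (simp add: field_simps)
    also have "norm \<dots> \<le> K * norm (\<gamma> + of_nat n)"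
      unfolding norm_mult by (intro mult_right_mono K) auto
    finally show ?thesis .
  qed
  have "norm (pochhammer \<alpha> n) \<le> K ^ n * norm (pochhammer \<gamma> n)" for n
  proof (induction n)
    case (Suc n)
    have "norm (pochhammer \<alpha> n) * norm (\<alpha> + of_nat n) \<le>
        (K ^ n * norm (pochhammer \<gamma> n)) * (K * norm (\<gamma> + of_nat n))"
      using Suc ratio K by (intro mult_mono) auto
    then show ?case
      by (simp add: pochhammer_Suc norm_mult mult_ac)
  qed auto
  with K show thesis
    using that by blast
qed

text \<open>
  The power series is dominated term by term by that of \<open>exp (K * norm z)\<close>.
\<close>
lemma kummer_exponential_type:
  assumes "\<gamma> \<notin> \<int>\<^sub>\<le>\<^sub>0"
  obtains K where "K > 0" "\<And>z. norm (kummer \<alpha> \<gamma> z) \<le> exp (K * norm z)" "kummer \<alpha> \<gamma> holomorphic_on UNIV"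
proof -
  obtain K where K: "K > 0" "\<And>n. norm (pochhammer \<alpha> n) \<le> K ^ n * norm (pochhammer \<gamma> n)"
    using pochhammer_ratio_bounded[OF assms] by blast
  define c where "c = (\<lambda>n. pochhammer \<alpha> n / (fact n * pochhammer \<gamma> n))"
  have nz: "pochhammer \<gamma> n \<noteq> 0" for n
    using assms by (auto simp: pochhammer_eq_0_iff)
  have le: "norm (c n * z ^ n) \<le> (K * norm z) ^ n /\<^sub>R fact n" for n z
  proof -
    have "norm (c n) \<le> K ^ n / fact n"
      using K(2)[of n] nz[of n] by (simp add: c_def norm_divide norm_mult field_simps)
    then have "norm (c n) * norm z ^ n \<le> K ^ n / fact n * norm z ^ n"
      by (intro mult_right_mono) auto
    then show ?thesis
      by (simp add: norm_mult norm_power power_mult_distrib field_simps)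
  qed
  have summ: "summable (\<lambda>n. c n * z ^ n)" for z
    using le by (rule summable_comparison_test'[OF sums_summable[OF exp_converges], of 0])
  have kum: "kummer \<alpha> \<gamma> z = (\<Sum>n. c n * z ^ n)" for z
    by (simp add: kummer_def c_def)
  have "norm (kummer \<alpha> \<gamma> z) \<le> exp (K * norm z)" for z
    unfolding kum using norm_suminf_le[OF le sums_summable[OF exp_converges]]
    by (simp add: exp_def)
  moreover have "kummer \<alpha> \<gamma> holomorphic_on ball 0 r" for r
    by (rule power_series_holomorphic[where a = c]) (use summ in \<open>simp add: kum summable_sums\<close>)
  then have "kummer \<alpha> \<gamma> field_differentiable at z" for z
    using holomorphic_on_imp_differentiable_at[of _ "ball 0 (norm z + 1)" z] by auto
  then have "kummer \<alpha> \<gamma> holomorphic_on UNIV"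
    by (simp add: holomorphic_on_def)
  ultimately show thesis
    using that K by blast
qed

lemma kummer_0: "kummer \<alpha> \<gamma> 0 = 1"
  using powser_zero[of "\<lambda>n. pochhammer \<alpha> n / (fact n * pochhammer \<gamma> n)"] by (simp add: kummer_def)

text \<open>
  The quotient \<open>f / g\<close> extends to an entire function without zeros, which has an entire logarithm.
\<close>
lemma share_CM_0_imp_exp_factor:
  assumes hol: "f holomorphic_on UNIV" "g holomorphic_on UNIV" and nz: "f z1 \<noteq> 0" "g z2 \<noteq> 0"
    and share: "share_CM f g 0"
  obtains h where "h holomorphic_on UNIV" "\<And>z. f z = g z * exp (h z)"
proof -
  have mult: "preimage_mult f 0 z = preimage_mult g 0 z" for z
    using share by (simp add: share_CM_def)
  have f_zero: "f z = 0 \<longleftrightarrow> preimage_mult f 0 z > 0" for z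
    using preimage_eq_support[OF hol(1), of 0] nz by (auto simp: preimage_def)
  have g_zero: "g z = 0 \<longleftrightarrow> preimage_mult g 0 z > 0" for z
    using preimage_eq_support[OF hol(2), of 0] nz by (auto simp: preimage_def)
  have zeros: "g z = 0 \<longleftrightarrow> f z = 0" for z
    using f_zero g_zero mult by simp
  have ord: "zorder g z = zorder f z" for z
  proof (cases "f z = 0")
    case True
    then have "g z = 0"
      using zeros by simp
    have "nat (zorder f z) = nat (zorder g z)" "nat (zorder f z) > 0"
      using mult[of z] f_zero[of z] True \<open>g z = 0\<close> by (simp_all add: preimage_mult_def preimage_def)
    then show ?thesis
      by linarith
  next
    case False
    then have "g z \<noteq> 0"
      using zeros by simp
    moreover have "zorder f z = 0" if "f z \<noteq> 0"
      using zorder_exist_zero[OF hol(1) open_UNIV connected_UNIV UNIV_I, of z] nz(1) that by auto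
    moreover have "zorder g z = 0" if "g z \<noteq> 0"
      using zorder_exist_zero[OF hol(2) open_UNIV connected_UNIV UNIV_I, of z] nz(2) that by auto
    ultimately show ?thesis
      using False by simp
  qed
  obtain u where u: "u holomorphic_on UNIV" "\<And>z. z \<in> UNIV \<Longrightarrow> u z \<noteq> 0" "\<And>z. z \<in> UNIV \<Longrightarrow> f z = u z * g z"
    by (rule holomorphic_zorder_factorization[OF hol(1) open_UNIV connected_UNIV hol(2) zeros ord]) blast
  obtain h where "h holomorphic_on UNIV" "\<And>z. z \<in> UNIV \<Longrightarrow> u z = exp (h z)"
    by (rule contractible_imp_holomorphic_log[OF u(1) contractible_UNIV u(2)], assumption) (rule that; assumption)
  with u(3) show thesis
    using that[of h] by simp
qed

theorem theorem5p1:
  fixes f g :: "complex \<Rightarrow> complex" and \<alpha> \<gamma> a :: complex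
  assumes "f holomorphic_on UNIV" and "f 0 = 1"
    and "\<gamma> \<notin> \<int>\<^sub>\<le>\<^sub>0" and "g = kummer \<alpha> \<gamma>"
    and "share_CM f g 0"
    and "a \<noteq> 0" and "\<exists>z. g z \<noteq> a" and "preimage f a \<subseteq> preimage g a"
    and "deriv f 0 = deriv g 0"
  shows "f = g"
proof -
  obtain K where K: "K > 0" "\<And>z. norm (g z) \<le> exp (K * norm z)" and g_hol: "g holomorphic_on UNIV"
    using kummer_exponential_type[OF assms(3), of \<alpha>] assms(4) by metis
  have g0: "g 0 = 1"
    by (simp add: assms(4) kummer_0)
  obtain h where h_hol: "h holomorphic_on UNIV" and h: "\<And>z. f z = g z * exp (h z)"
    using share_CM_0_imp_exp_factor[OF assms(1) g_hol, of 0 0] assms(2,5) g0 by auto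
  obtain z1 where z1: "g z1 - a \<noteq> 0"
    using assms(7) by auto
  have affine: "h z = h 0 + deriv h 0 * z" for z
  proof (rule exponent_affine[where g = g and w = "\<lambda>z. g z - a" and K = "K + norm a" and a = a])
    show "norm (g z) \<le> exp ((K + norm a) * (1 + norm z))" for z
      by (rule order.trans[OF K(2)]) (use K(1) in \<open>simp add: algebra_simps\<close>)
    show "norm (g z - a) \<le> exp ((K + norm a) * (1 + norm z))" for z
    proof -
      have "norm (g z - a) \<le> exp (K * norm z) + norm a"
        using norm_triangle_ineq4[of "g z" a] K(2)[of z] by simp
      also have "\<dots> \<le> exp (K * norm z) * (1 + norm a)"
        using K(1) mult_right_mono[of 1 "exp (K * norm z)" "norm a"] by (simp add: algebra_simps)
      also have "\<dots> \<le> exp (K * norm z) * exp (norm a)"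
        using exp_ge_add_one_self[of "norm a"] by (intro mult_left_mono) auto
      also have "\<dots> \<le> exp ((K + norm a) * (1 + norm z))"
        using K(1) by (simp add: algebra_simps flip: exp_add)
      finally show ?thesis .
    qed
    show "g z - a = 0" if "g z * exp (h z) = a" for z
      using assms(8) that h[of z] by (auto simp: preimage_def)
    show "g 0 \<noteq> 0"
      using g0 by simp
  qed (use assms g_hol h_hol z1 K in \<open>auto intro!: holomorphic_intros\<close>)
  have exp_h0: "exp (h 0) = 1"
    using h[of 0] g0 assms(2) by simp
  have "deriv h 0 = 0"
  proof -
    have "(h has_field_derivative deriv h 0) (at 0)" "(g has_field_derivative deriv g 0) (at 0)"
      using h_hol g_hol by (auto intro: holomorphic_derivI)
    then have "((\<lambda>z. g z * exp (h z)) has_field_derivative deriv g 0 + deriv h 0) (at 0)"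
      by (auto intro!: derivative_eq_intros simp: g0 exp_h0)
    then have "deriv f 0 = deriv g 0 + deriv h 0"
      unfolding h[abs_def] by (rule DERIV_imp_deriv)
    with assms(9) show ?thesis
      by simp
  qed
  then have "h z = h 0" for z
    using affine[of z] by simp
  then have "exp (h z) = 1" for z
    using exp_h0 by metis
  with h show ?thesis
    by auto
qed

end
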